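(* Let $E$ and $F$ be any two non-isometric $2$-dimensional normed spaces. Then there are uncountably many geodesics between $E$ and $F$ in $(BM_2,\log d)$, where geodesics are counted by the subsets of $BM_2$ they trace out.
   Context: All normed spaces are real. For $n$-dimensional normed spaces $E,F$, the (multiplicative) Banach-Mazur distance is $d(E,F)=\inf\{\|T\|\,\|T^{-1}\| : T:E\to F \text{ is an isomorphism}\}$. $BM_2$ is the set of isometry classes of $2$-dimensional normed spaces, with the metric $\log d$; a space is identified with its isometry class. In a metric space $(M,\rho)$, the length of a path $\gamma:[a,b]\to M$ is $L(\gamma)=\sup\sum_{i=1}^m\rho(\gamma(t_i),\gamma(t_{i-1}))$ over all partitions $a=t_0\le t_1\le\cdots\le t_m=b$; a geodesic between $x$ and $y$ is a path $\gamma$ starting at $x$, ending at $y$, with $L(\gamma)=\rho(x,y)$. Two geodesics with the same image are regarded as the same. *)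

theory Defs
  imports "HOL-Analysis.Analysis"
begin

section \<open>Two-dimensional normed spaces\<close>

text \<open>A two-dimensional normed space is a two-dimensional real vector space (a type of class
  \<^class>\<open>real_vector\<close>) together with a norm, given as an explicit function so that different norms
  on the same vector space can be considered. Nonnegativity follows from the conditions below.\<close>

definition normed_plane :: "('a::real_vector \<Rightarrow> real) \<Rightarrow> bool" where
  "normed_plane E \<longleftrightarrow>
     dim (UNIV :: 'a set) = 2 \<and>
     (\<forall>x. E x = 0 \<longleftrightarrow> x = 0) \<and>
     (\<forall>c x. E (c *\<^sub>R x) = \<bar>c\<bar> * E x) \<and>
     (\<forall>x y. E (x + y) \<le> E x + E y)"

definition isometric :: "('a::real_vector \<Rightarrow> real) \<Rightarrow> ('b::real_vector \<Rightarrow> real) \<Rightarrow> bool" where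
  "isometric E F \<longleftrightarrow> (\<exists>T. linear T \<and> bij T \<and> (\<forall>x. F (T x) = E x))"

text \<open>As in the library's \<^const>\<open>onorm\<close>, the point \<open>x = 0\<close> contributes \<open>0 / 0 = 0\<close> to the supremum.\<close>

definition op_norm ::
  "('a::real_vector \<Rightarrow> real) \<Rightarrow> ('b::real_vector \<Rightarrow> real) \<Rightarrow> ('a \<Rightarrow> 'b) \<Rightarrow> real" where
  "op_norm E F T = (SUP x. F (T x) / E x)"

definition banach_mazur :: "('a::real_vector \<Rightarrow> real) \<Rightarrow> ('b::real_vector \<Rightarrow> real) \<Rightarrow> real" where
  "banach_mazur E F = Inf {op_norm E F T * op_norm F E (inv T) | T. linear T \<and> bij T}"


subsection \<open>Basic properties\<close>

lemma normed_plane_zero: "normed_plane E \<Longrightarrow> E 0 = 0"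
  by (simp add: normed_plane_def)

lemma normed_plane_eq_0: "normed_plane E \<Longrightarrow> E x = 0 \<longleftrightarrow> x = 0"
  by (simp add: normed_plane_def)

lemma normed_plane_scale: "normed_plane E \<Longrightarrow> E (c *\<^sub>R x) = \<bar>c\<bar> * E x"
  by (simp add: normed_plane_def)

lemma normed_plane_add: "normed_plane E \<Longrightarrow> E (x + y) \<le> E x + E y"
  by (simp add: normed_plane_def)

lemma normed_plane_minus: "normed_plane E \<Longrightarrow> E (- x) = E x"
  using normed_plane_scale[of E "-1" x] by simp

lemma normed_plane_nonneg:
  assumes "normed_plane E" shows "0 \<le> E x"
  using normed_plane_add[OF assms, of x "- x"] normed_plane_minus[OF assms, of x]
    normed_plane_zero[OF assms] by simp

lemma normed_plane_pos: "normed_plane E \<Longrightarrow> x \<noteq> 0 \<Longrightarrow> 0 < E x"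
  using normed_plane_nonneg[of E x] normed_plane_eq_0[of E x] by linarith

lemma normed_plane_norm: "normed_plane (norm :: real^2 \<Rightarrow> real)"
  by (simp add: normed_plane_def norm_triangle_ineq dim_UNIV)

lemma linear_inv_bij:
  fixes T :: "'a::real_vector \<Rightarrow> 'b::real_vector"
  assumes "linear T" "bij T" shows "linear (inv T)"
proof (rule linearI)
  have i: "T (inv T y) = y" for y
    using assms(2) by (simp add: bij_is_surj surj_f_inv_f)
  have j: "inv T (T x) = x" for x
    using assms(2) by (simp add: bij_is_inj)
  show "inv T (x + y) = inv T x + inv T y" for x y
    using j[of "inv T x + inv T y"] by (simp add: linear_add[OF assms(1)] i)
  show "inv T (c *\<^sub>R x) = c *\<^sub>R inv T x" for c x
    using j[of "c *\<^sub>R inv T x"] by (simp add: linear_scale[OF assms(1)] i)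
qed

lemma isometric_refl: "isometric E E"
  unfolding isometric_def by (intro exI[of _ "\<lambda>x. x"]) (auto simp: linear_iff bij_def)

lemma isometric_sym:
  assumes "isometric E F" shows "isometric F E"
proof -
  obtain T where T: "linear T" "bij T" "\<And>x. F (T x) = E x"
    using assms by (auto simp: isometric_def)
  have "E (inv T y) = F y" for y
    by (metis T(2,3) bij_inv_eq_iff)
  then show ?thesis
    unfolding isometric_def using linear_inv_bij[OF T(1,2)] bij_imp_bij_inv[OF T(2)] by blast
qed

lemma isometric_trans:
  assumes "isometric E F" "isometric F G" shows "isometric E G"
proof -
  obtain T U where T: "linear T" "bij T" "\<And>x. F (T x) = E x"
    and U: "linear U" "bij U" "\<And>x. G (U x) = F x"
    using assms by (auto simp: isometric_def)
  show ?thesis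
    unfolding isometric_def
    using linear_compose[OF T(1) U(1)] bij_comp[OF T(2) U(2)] T(3) U(3) by (auto intro!: exI[of _ "U \<circ> T"])
qed

lemma plane_coordinates:
  assumes "dim (UNIV :: 'a::real_vector set) = 2"
  shows "\<exists>T :: real^2 \<Rightarrow> 'a. linear T \<and> bij T"
proof -
  obtain B where B: "B \<subseteq> (UNIV :: 'a set)" "independent B" "UNIV \<subseteq> span B" "card B = 2"
    using basis_exists[of "UNIV :: 'a set"] unfolding assms .
  then obtain b c where bc: "B = {b, c}" "b \<noteq> c"
    by (meson card_2_iff)
  define T where "T v = (v $ 1) *\<^sub>R b + (v $ 2) *\<^sub>R c" for v :: "real^2"
  have lin: "linear T"
    by (rule linearI) (auto simp: T_def algebra_simps)
  have "B - {b} = {c}" using bc by auto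
  moreover have "b \<notin> span (B - {b})"
    using B(2) bc(1) unfolding dependent_def by blast
  ultimately have bspan: "b \<notin> span {c}" by simp
  have "c \<noteq> 0"
    using B(2) bc(1) dependent_zero[of B] by auto
  have inj: "v = 0" if "T v = 0" for v
  proof -
    have "v $ 1 = 0"
    proof (rule ccontr)
      assume n: "v $ 1 \<noteq> 0"
      have "(v $ 1) *\<^sub>R b = (- (v $ 2)) *\<^sub>R c"
        using that by (simp add: T_def eq_neg_iff_add_eq_0)
      then have "inverse (v $ 1) *\<^sub>R ((v $ 1) *\<^sub>R b) = inverse (v $ 1) *\<^sub>R ((- (v $ 2)) *\<^sub>R c)"
        by simp
      then have "b = (inverse (v $ 1) * (- (v $ 2))) *\<^sub>R c"
        using n by simp
      then have "b \<in> span {c}"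
        unfolding span_singleton by (rule range_eqI)
      then show False using bspan by simp
    qed
    moreover from this have "v $ 2 = 0"
      using that \<open>c \<noteq> 0\<close> by (simp add: T_def)
    ultimately show ?thesis by (simp add: vec_eq_iff forall_2)
  qed
  have "\<exists>v. T v = x" for x
  proof -
    have "x \<in> span {b, c}" using B(3) bc(1) by blast
    then obtain k where "x - k *\<^sub>R b \<in> span {c}"
      by (auto simp: span_insert)
    then obtain l where "x - k *\<^sub>R b = l *\<^sub>R c"
      by (auto simp: span_singleton)
    then have "x = k *\<^sub>R b + l *\<^sub>R c"
      by (metis add.commute diff_add_cancel)
    then have "T (vector [k, l]) = x"
      by (simp only: T_def vector_2)
    then show ?thesis by blast
  qed
  then have "surj T" unfolding surj_def by metis
  moreover have "inj T" using linear_injective_0[OF lin] inj by blast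
  ultimately have "bij T" by (simp add: bij_def)
  then show ?thesis using lin by blast
qed

lemma normed_plane_compose:
  fixes T :: "real^2 \<Rightarrow> 'a::real_vector"
  assumes "normed_plane E" "linear T" "bij T"
  shows "normed_plane (\<lambda>x. E (T x))"
  using assms linear_injective_0[OF assms(2)]
  by (auto simp: normed_plane_def linear_add linear_scale linear_0 dim_UNIV bij_def)

lemma normed_plane_coordinates:
  fixes E :: "'a::real_vector \<Rightarrow> real"
  assumes "normed_plane E"
  shows "\<exists>N :: real^2 \<Rightarrow> real. normed_plane N \<and> isometric N E"
proof -
  obtain T :: "real^2 \<Rightarrow> 'a" where T: "linear T" "bij T"
    using plane_coordinates assms by (auto simp: normed_plane_def)
  then show ?thesis
    using normed_plane_compose[OF assms T] by (auto simp: isometric_def)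
qed

lemma seminorm_upper:
  fixes G :: "real^2 \<Rightarrow> real"
  assumes scale: "\<And>c x. G (c *\<^sub>R x) = \<bar>c\<bar> * G x" and add: "\<And>x y. G (x + y) \<le> G x + G y"
    and nonneg: "\<And>x. 0 \<le> G x"
  shows "\<exists>C>0. \<forall>x. G x \<le> C * norm x"
proof (intro exI conjI allI)
  let ?C = "G (axis 1 1) + G (axis 2 1) + 1"
  show "0 < ?C" using nonneg[of "axis 1 1"] nonneg[of "axis 2 1"] by linarith
  fix x :: "real^2"
  have "x = (x $ 1) *\<^sub>R axis 1 1 + (x $ 2) *\<^sub>R axis 2 1"
    by (simp add: vec_eq_iff forall_2 axis_def)
  then have "G x \<le> \<bar>x $ 1\<bar> * G (axis 1 1) + \<bar>x $ 2\<bar> * G (axis 2 1)"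
    by (metis add scale)
  also have "\<dots> \<le> norm x * G (axis 1 1) + norm x * G (axis 2 1)"
    by (intro add_mono mult_right_mono component_le_norm_cart nonneg)
  also have "\<dots> \<le> ?C * norm x"
    by (simp add: algebra_simps)
  finally show "G x \<le> ?C * norm x" .
qed

lemma normed_plane_upper:
  fixes E :: "real^2 \<Rightarrow> real"
  assumes "normed_plane E" shows "\<exists>C>0. \<forall>x. E x \<le> C * norm x"
  using seminorm_upper normed_plane_scale[OF assms] normed_plane_add[OF assms]
    normed_plane_nonneg[OF assms] by blast

lemma normed_plane_continuous:
  fixes E :: "real^2 \<Rightarrow> real"
  assumes "normed_plane E" shows "continuous_on S E"
proof -
  obtain C where C: "C > 0" "\<And>x. E x \<le> C * norm x"
    using normed_plane_upper[OF assms] by blast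
  have "dist (E x) (E y) \<le> C * dist x y" for x y
  proof -
    have "E x \<le> E (x - y) + E y" "E y \<le> E (y - x) + E x"
      using normed_plane_add[OF assms, of "x - y" y] normed_plane_add[OF assms, of "y - x" x] by auto
    moreover have "E (y - x) = E (x - y)"
      using normed_plane_minus[OF assms, of "x - y"] by simp
    ultimately show ?thesis
      using C(2)[of "x - y"] by (simp add: dist_norm)
  qed
  then have "C-lipschitz_on S E"
    using C(1) by (auto simp: lipschitz_on_def)
  then show ?thesis by (rule lipschitz_on_continuous_on)
qed

lemma normed_plane_lower:
  fixes E :: "real^2 \<Rightarrow> real"
  assumes "normed_plane E" shows "\<exists>C>0. \<forall>x. norm x \<le> C * E x"
proof -
  have "\<exists>u\<in>sphere (0 :: real^2) 1. \<forall>y\<in>sphere 0 1. E u \<le> E y"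
    by (rule continuous_attains_inf[OF compact_sphere _ normed_plane_continuous[OF assms]]) simp
  then obtain u :: "real^2" where u: "norm u = 1" and min: "\<And>y. norm y = 1 \<Longrightarrow> E u \<le> E y"
    by auto
  have "u \<noteq> 0" using u by auto
  then have pos: "E u > 0"
    by (rule normed_plane_pos[OF assms])
  have "norm x \<le> inverse (E u) * E x" for x
  proof (cases "x = 0")
    case False
    then have "E u \<le> E (inverse (norm x) *\<^sub>R x)"
      by (intro min) simp
    then show ?thesis
      using False pos normed_plane_scale[OF assms] by (simp add: field_simps)
  qed (use normed_plane_zero[OF assms] in simp)
  then show ?thesis using pos by (intro exI[of _ "inverse (E u)"]) simp
qed

lemma normed_plane_linear_bounded:
  fixes E :: "'a::real_vector \<Rightarrow> real" and F :: "'b::real_vector \<Rightarrow> real"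
  assumes "normed_plane E" "normed_plane F" "linear T"
  shows "\<exists>C>0. \<forall>x. F (T x) \<le> C * E x"
proof -
  obtain P :: "real^2 \<Rightarrow> 'a" where P: "linear P" "bij P"
    using plane_coordinates assms by (auto simp: normed_plane_def)
  obtain C where C: "C > 0" "\<And>v. norm v \<le> C * E (P v)"
    using normed_plane_lower[OF normed_plane_compose[OF assms(1) P]] by blast
  have "\<exists>D>0. \<forall>v. F (T (P v)) \<le> D * norm v"
    by (rule seminorm_upper)
      (simp_all add: linear_scale linear_add P assms normed_plane_scale normed_plane_add
        normed_plane_nonneg)
  then obtain D where D: "D > 0" "\<And>v. F (T (P v)) \<le> D * norm v"
    by blast
  have "F (T x) \<le> (D * C) * E x" for x
  proof -
    obtain v where v: "x = P v" using P(2) by (metis bij_pointE)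
    have "F (T x) \<le> D * norm v" using D(2) v by simp
    also have "\<dots> \<le> D * (C * E x)" using C(2)[of v] D(1) v by (intro mult_left_mono) auto
    finally show ?thesis by (simp add: mult.assoc)
  qed
  then show ?thesis using C(1) D(1) by (intro exI[of _ "D * C"]) simp
qed

lemma op_norm_least:
  assumes "normed_plane E" "0 \<le> C" "\<And>x. F (T x) \<le> C * E x"
  shows "op_norm E F T \<le> C"
  unfolding op_norm_def
proof (rule cSUP_least)
  fix x
  show "F (T x) / E x \<le> C"
    using assms normed_plane_nonneg[OF assms(1), of x]
    by (cases "E x = 0") (auto simp: divide_le_eq)
qed simp

lemma op_norm_bound:
  assumes "normed_plane E" "normed_plane F" "linear T"
  shows "F (T x) \<le> op_norm E F T * E x"
proof (cases "x = 0")
  case True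
  then show ?thesis
    using assms by (simp add: linear_0 normed_plane_zero)
next
  case False
  then have pos: "E x > 0" using normed_plane_pos assms(1) by blast
  obtain C where C: "C > 0" "\<And>x. F (T x) \<le> C * E x"
    using normed_plane_linear_bounded[OF assms] by blast
  have "F (T y) / E y \<le> C" for y
    using C normed_plane_nonneg[OF assms(1), of y]
    by (cases "E y = 0") (auto simp: divide_le_eq)
  then have "bdd_above (range (\<lambda>y. F (T y) / E y))"
    by (auto intro!: bdd_aboveI2)
  then have "F (T x) / E x \<le> op_norm E F T"
    unfolding op_norm_def by (intro cSUP_upper) auto
  then show ?thesis using pos by (simp add: divide_le_eq)
qed

lemma op_norm_nonneg:
  assumes "normed_plane E" "normed_plane F" "linear T"
  shows "0 \<le> op_norm E F T"
proof -
  obtain P :: "real^2 \<Rightarrow> 'a" where P: "linear P" "bij P"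
    using plane_coordinates assms(1) by (auto simp: normed_plane_def)
  define x where "x = P (axis 1 1)"
  have "x \<noteq> 0"
    unfolding x_def using linear_injective_0[OF P(1)] P(2)
    by (metis axis_eq_0_iff bij_is_inj zero_neq_one)
  then have "0 < E x" using normed_plane_pos assms(1) by blast
  moreover have "0 \<le> op_norm E F T * E x"
    using op_norm_bound[OF assms, of x] normed_plane_nonneg[OF assms(2), of "T x"] by linarith
  ultimately show ?thesis by (simp add: zero_le_mult_iff)
qed

lemma op_norm_inv_ge_1:
  assumes "normed_plane E" "normed_plane F" "linear T" "bij T"
  shows "1 \<le> op_norm E F T * op_norm F E (inv T)"
proof -
  obtain P :: "real^2 \<Rightarrow> 'a" where P: "linear P" "bij P"
    using plane_coordinates assms(1) by (auto simp: normed_plane_def)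
  define x where "x = P (axis 1 1)"
  have "x \<noteq> 0"
    unfolding x_def using linear_injective_0[OF P(1)] P(2)
    by (metis axis_eq_0_iff bij_is_inj zero_neq_one)
  then have pos: "0 < E x" using normed_plane_pos assms(1) by blast
  note lin = linear_inv_bij[OF assms(3,4)]
  have "E x = E (inv T (T x))"
    using assms(4) by (simp add: bij_is_inj)
  also have "\<dots> \<le> op_norm F E (inv T) * F (T x)"
    by (rule op_norm_bound[OF assms(2,1) lin])
  also have "\<dots> \<le> op_norm F E (inv T) * (op_norm E F T * E x)"
    by (intro mult_left_mono op_norm_bound assms op_norm_nonneg lin)
  finally have "1 * E x \<le> (op_norm E F T * op_norm F E (inv T)) * E x"
    by (simp add: ac_simps)
  then show ?thesis using pos by simp
qed

lemma op_norm_comp: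
  assumes "normed_plane E" "normed_plane F" "normed_plane G" "linear T" "linear U"
  shows "op_norm E G (U \<circ> T) \<le> op_norm E F T * op_norm F G U"
proof (rule op_norm_least)
  show "0 \<le> op_norm E F T * op_norm F G U"
    by (intro mult_nonneg_nonneg op_norm_nonneg assms)
  fix x
  have "G (U (T x)) \<le> op_norm F G U * F (T x)"
    by (intro op_norm_bound assms)
  also have "\<dots> \<le> op_norm F G U * (op_norm E F T * E x)"
    by (intro mult_left_mono op_norm_bound assms op_norm_nonneg)
  finally show "G ((U \<circ> T) x) \<le> op_norm E F T * op_norm F G U * E x"
    by (simp add: ac_simps)
qed fact

lemma banach_mazur_lower:
  assumes "normed_plane E" "normed_plane F" "linear T" "bij T"
  shows "banach_mazur E F \<le> op_norm E F T * op_norm F E (inv T)"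
  unfolding banach_mazur_def
  using assms op_norm_inv_ge_1[OF assms(1,2)]
  by (intro cInf_lower) (auto intro!: bdd_belowI[of _ 1])

lemma ex_linear_bij:
  fixes E :: "'a::real_vector \<Rightarrow> real" and F :: "'b::real_vector \<Rightarrow> real"
  assumes "normed_plane E" "normed_plane F"
  shows "\<exists>T :: 'a \<Rightarrow> 'b. linear T \<and> bij T"
proof -
  obtain P :: "real^2 \<Rightarrow> 'a" where P: "linear P" "bij P"
    using plane_coordinates assms(1) by (auto simp: normed_plane_def)
  obtain Q :: "real^2 \<Rightarrow> 'b" where Q: "linear Q" "bij Q"
    using plane_coordinates assms(2) by (auto simp: normed_plane_def)
  show ?thesis
    using linear_compose[OF linear_inv_bij[OF P] Q(1)] bij_comp[OF bij_imp_bij_inv[OF P(2)] Q(2)]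
    by blast
qed

lemma banach_mazur_greatest:
  assumes "normed_plane E" "normed_plane F"
    and "\<And>T. linear T \<Longrightarrow> bij T \<Longrightarrow> C \<le> op_norm E F T * op_norm F E (inv T)"
  shows "C \<le> banach_mazur E F"
  unfolding banach_mazur_def
  using assms(3) ex_linear_bij[OF assms(1,2)] by (intro cInf_greatest) auto

lemma banach_mazur_ge_1:
  "normed_plane E \<Longrightarrow> normed_plane F \<Longrightarrow> 1 \<le> banach_mazur E F"
  by (intro banach_mazur_greatest op_norm_inv_ge_1)

lemma banach_mazur_sym:
  assumes "normed_plane E" "normed_plane F"
  shows "banach_mazur E F = banach_mazur F E"
proof (rule antisym)
  have *: "banach_mazur E F \<le> banach_mazur F E" if "normed_plane E" "normed_plane F"
    for E :: "'c::real_vector \<Rightarrow> real" and F :: "'d::real_vector \<Rightarrow> real"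
  proof (rule banach_mazur_greatest[OF that(2,1)])
    fix T :: "'d \<Rightarrow> 'c" assume T: "linear T" "bij T"
    show "banach_mazur E F \<le> op_norm F E T * op_norm E F (inv T)"
      using banach_mazur_lower[OF that linear_inv_bij[OF T] bij_imp_bij_inv[OF T(2)]]
      by (simp add: inv_inv_eq[OF T(2)] mult.commute)
  qed
  show "banach_mazur E F \<le> banach_mazur F E" by (rule *[OF assms])
  show "banach_mazur F E \<le> banach_mazur E F" by (rule *[OF assms(2,1)])
qed

lemma banach_mazur_triangle:
  fixes E :: "'a::real_vector \<Rightarrow> real" and F :: "'b::real_vector \<Rightarrow> real"
    and G :: "'c::real_vector \<Rightarrow> real"
  assumes E: "normed_plane E" and F: "normed_plane F" and G: "normed_plane G"
  shows "banach_mazur E G \<le> banach_mazur E F * banach_mazur F G"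
proof -
  have "banach_mazur E G / banach_mazur F G \<le> banach_mazur E F"
  proof (rule banach_mazur_greatest[OF E F])
    fix T :: "'a \<Rightarrow> 'b" assume T: "linear T" "bij T"
    let ?p = "op_norm E F T * op_norm F E (inv T)"
    have p: "1 \<le> ?p" by (rule op_norm_inv_ge_1[OF E F T])
    have "banach_mazur E G / ?p \<le> banach_mazur F G"
    proof (rule banach_mazur_greatest[OF F G])
      fix U :: "'b \<Rightarrow> 'c" assume U: "linear U" "bij U"
      note lT = linear_inv_bij[OF T] and lU = linear_inv_bij[OF U]
      have "banach_mazur E G \<le> op_norm E G (U \<circ> T) * op_norm G E (inv (U \<circ> T))"
        by (intro banach_mazur_lower E G linear_compose T U bij_comp)
      also have "inv (U \<circ> T) = inv T \<circ> inv U"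
        by (rule o_inv_distrib[OF U(2) T(2)])
      also have "op_norm E G (U \<circ> T) * op_norm G E (inv T \<circ> inv U)
          \<le> (op_norm E F T * op_norm F G U) * (op_norm G F (inv U) * op_norm F E (inv T))"
        by (intro mult_mono op_norm_comp E F G T(1) U(1) lT lU mult_nonneg_nonneg op_norm_nonneg
            linear_compose)
      finally show "banach_mazur E G / ?p \<le> op_norm F G U * op_norm G F (inv U)"
        using p by (simp add: divide_le_eq ac_simps)
    qed
    then show "banach_mazur E G / banach_mazur F G \<le> ?p"
      using p banach_mazur_ge_1[OF F G] by (simp add: divide_le_eq ac_simps)
  qed
  then show ?thesis
    using banach_mazur_ge_1[OF F G] by (simp add: divide_le_eq)
qed

lemma banach_mazur_isometric:
  assumes "normed_plane E" "normed_plane F" "isometric E F"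
  shows "banach_mazur E F = 1"
proof -
  obtain T where T: "linear T" "bij T" "\<And>x. F (T x) = E x"
    using assms(3) by (auto simp: isometric_def)
  have inv: "E (inv T y) = F y" for y
    by (metis T(2,3) bij_inv_eq_iff)
  have "op_norm E F T \<le> 1" "op_norm F E (inv T) \<le> 1"
    by (auto intro!: op_norm_least assms simp: T(3) inv)
  then have "op_norm E F T * op_norm F E (inv T) \<le> 1 * 1"
    by (intro mult_mono op_norm_nonneg assms linear_inv_bij T) auto
  then show ?thesis
    using banach_mazur_lower[OF assms(1,2) T(1,2)] banach_mazur_ge_1[OF assms(1,2)] by linarith
qed

lemma banach_mazur_cong:
  assumes "normed_plane E" "normed_plane E'" "normed_plane F" "normed_plane F'"
    "isometric E E'" "isometric F F'"
  shows "banach_mazur E F = banach_mazur E' F'"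
proof (rule antisym)
  have "banach_mazur E F \<le> banach_mazur E E' * (banach_mazur E' F' * banach_mazur F' F)"
    using banach_mazur_triangle[OF assms(1,2,3)] banach_mazur_triangle[OF assms(2,4,3)]
      banach_mazur_isometric[OF assms(1,2,5)] by simp
  then show "banach_mazur E F \<le> banach_mazur E' F'"
    using assms by (simp add: banach_mazur_isometric isometric_sym)
  have "banach_mazur E' F' \<le> banach_mazur E' E * (banach_mazur E F * banach_mazur F F')"
    using banach_mazur_triangle[OF assms(2,1,4)] banach_mazur_triangle[OF assms(1,3,4)]
      banach_mazur_isometric[OF assms(2,1)] isometric_sym[OF assms(5)] by simp
  then show "banach_mazur E' F' \<le> banach_mazur E F"
    using assms by (simp add: banach_mazur_isometric isometric_sym)
qed

lemma banach_mazur_1_imp_isometric_aux: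
  fixes E F :: "real^2 \<Rightarrow> real"
  assumes E: "normed_plane E" and F: "normed_plane F" and eq: "banach_mazur E F = 1"
  shows "isometric E F"
proof -
  have "\<exists>T S. linear T \<and> linear S \<and> (\<forall>x. S (T x) = x) \<and> (\<forall>y. T (S y) = y) \<and>
      (\<forall>x. F (T x) \<le> E x) \<and> (\<forall>y. E (S y) \<le> (1 + inverse (real (Suc n))) * F y)" for n
  proof -
    have "banach_mazur E F < 1 + inverse (real (Suc n))"
      using eq by simp
    then obtain T where T: "linear T" "bij T"
      and less: "op_norm E F T * op_norm F E (inv T) < 1 + inverse (real (Suc n))"
      using banach_mazur_greatest[OF E F, of "1 + inverse (real (Suc n))"] by (meson not_less)
    note lin = linear_inv_bij[OF T]
    let ?t = "op_norm E F T"
    have pos: "?t > 0"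
      using op_norm_inv_ge_1[OF E F T] op_norm_nonneg[OF E F T(1)]
      by (metis less_eq_real_def mult_zero_left not_one_le_zero)
    have 1: "F (inverse ?t *\<^sub>R T x) \<le> E x" for x
      using op_norm_bound[OF E F T(1), of x] pos by (simp add: normed_plane_scale[OF F] field_simps)
    have 2: "E (?t *\<^sub>R inv T y) \<le> (1 + inverse (real (Suc n))) * F y" for y
    proof -
      have "E (?t *\<^sub>R inv T y) \<le> ?t * (op_norm F E (inv T) * F y)"
        using op_norm_bound[OF F E lin, of y] pos by (simp add: normed_plane_scale[OF E])
      also have "\<dots> = (?t * op_norm F E (inv T)) * F y" by simp
      also have "\<dots> \<le> (1 + inverse (real (Suc n))) * F y"
        using less normed_plane_nonneg[OF F] by (intro mult_right_mono) auto
      finally show ?thesis .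
    qed
    have 3: "T (inv T y) = y" "inv T (T x) = x" for x y
      using T(2) by (simp_all add: bij_is_surj surj_f_inv_f bij_is_inj)
    show ?thesis
      using 1 2 3 T(1) lin pos
      by (intro exI[of _ "\<lambda>x. inverse ?t *\<^sub>R T x"] exI[of _ "\<lambda>y. ?t *\<^sub>R inv T y"])
        (simp_all add: linear_compose_scale_right linear_scale)
  qed
  then obtain T S where lT: "\<And>n. linear (T n)" and lS: "\<And>n. linear (S n)"
    and ST: "\<And>n x. S n (T n x) = x" and TS: "\<And>n y. T n (S n y) = y"
    and FT: "\<And>n x. F (T n x) \<le> E x"
    and ES: "\<And>n y. E (S n y) \<le> (1 + inverse (real (Suc n))) * F y"
    by metis
  obtain C where C: "C > 0" "\<And>x. norm x \<le> C * E x" using normed_plane_lower[OF E] by blast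
  obtain C' where C': "C' > 0" "\<And>x. norm x \<le> C' * F x" using normed_plane_lower[OF F] by blast
  obtain D where D: "D > 0" "\<And>x. E x \<le> D * norm x" using normed_plane_upper[OF E] by blast
  obtain D' where D': "D' > 0" "\<And>x. F x \<le> D' * norm x" using normed_plane_upper[OF F] by blast
  define p where "p n = (Blinfun (T n), Blinfun (S n))" for n
  have ap: "blinfun_apply (Blinfun (T n)) = T n" "blinfun_apply (Blinfun (S n)) = S n" for n
    using lT lS by (auto intro!: bounded_linear_Blinfun_apply simp: linear_conv_bounded_linear)
  have "norm (Blinfun (T n)) \<le> C' * D" for n
  proof (rule norm_blinfun_bound)
    show "0 \<le> C' * D" using C' D by simp
    fix x
    have "norm (T n x) \<le> C' * F (T n x)" by (rule C')
    also have "\<dots> \<le> C' * (D * norm x)"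
      using C' D(2)[of x] FT[of n x] by (intro mult_left_mono) auto
    finally show "norm (Blinfun (T n) x) \<le> C' * D * norm x" by (simp add: ap)
  qed
  moreover have "norm (Blinfun (S n)) \<le> C * (2 * D')" for n
  proof (rule norm_blinfun_bound)
    show "0 \<le> C * (2 * D')" using C D' by simp
    fix x
    have "norm (S n x) \<le> C * E (S n x)" by (rule C)
    also have "\<dots> \<le> C * ((1 + inverse (real (Suc n))) * F x)"
      using C ES by (intro mult_left_mono) auto
    also have "\<dots> \<le> C * (2 * (D' * norm x))"
      using C D' normed_plane_nonneg[OF F]
      by (intro mult_left_mono mult_mono) (auto simp: field_simps)
    finally show "norm (Blinfun (S n) x) \<le> C * (2 * D') * norm x" by (simp add: ap)
  qed
  ultimately have "range p \<subseteq> cball 0 (C' * D) \<times> cball 0 (C * (2 * D'))"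
    by (auto simp: p_def)
  then have "bounded (range p)"
    by (rule bounded_subset[OF bounded_Times[OF bounded_cball bounded_cball]])
  then obtain l r where r: "strict_mono (r :: nat \<Rightarrow> nat)" and lim: "(p \<circ> r) \<longlonglongrightarrow> l"
    using bounded_imp_convergent_subsequence by blast
  define T' S' where "T' = blinfun_apply (fst l)" and "S' = blinfun_apply (snd l)"
  have limT: "(\<lambda>n. T (r n) (f n)) \<longlonglongrightarrow> T' x" if "f \<longlonglongrightarrow> x" for f x
  proof -
    have "(\<lambda>n. blinfun_apply (fst ((p \<circ> r) n)) (f n)) \<longlonglongrightarrow> T' x"
      unfolding T'_def by (intro tendsto_intros lim that)
    then show ?thesis by (simp add: p_def ap)
  qed
  have limS: "(\<lambda>n. S (r n) (f n)) \<longlonglongrightarrow> S' x" if "f \<longlonglongrightarrow> x" for f x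
  proof -
    have "(\<lambda>n. blinfun_apply (snd ((p \<circ> r) n)) (f n)) \<longlonglongrightarrow> S' x"
      unfolding S'_def by (intro tendsto_intros lim that)
    then show ?thesis by (simp add: p_def ap)
  qed
  have TS': "T' (S' y) = y" for y
    using limT[OF limS[OF tendsto_const, of y]] by (simp add: TS LIMSEQ_const_iff)
  have ST': "S' (T' x) = x" for x
    using limS[OF limT[OF tendsto_const, of x]] by (simp add: ST LIMSEQ_const_iff)
  have contE: "(\<lambda>n. E (f n)) \<longlonglongrightarrow> E x" if "f \<longlonglongrightarrow> x" for f :: "nat \<Rightarrow> real^2" and x
    using continuous_on_tendsto_compose[OF normed_plane_continuous[OF E, of UNIV] that] by simp
  have contF: "(\<lambda>n. F (f n)) \<longlonglongrightarrow> F x" if "f \<longlonglongrightarrow> x" for f :: "nat \<Rightarrow> real^2" and x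
    using continuous_on_tendsto_compose[OF normed_plane_continuous[OF F, of UNIV] that] by simp
  have FT': "F (T' x) \<le> E x" for x
    by (rule LIMSEQ_le_const2[OF contF[OF limT[OF tendsto_const]]]) (use FT in blast)
  have ES': "E (S' y) \<le> F y" for y
  proof -
    have "(\<lambda>n. inverse (real (Suc (r n)))) \<longlonglongrightarrow> 0"
      using LIMSEQ_subseq_LIMSEQ[OF LIMSEQ_inverse_real_of_nat r] by (simp add: o_def)
    then have "(\<lambda>n. (1 + inverse (real (Suc (r n)))) * F y) \<longlonglongrightarrow> (1 + 0) * F y"
      by (intro tendsto_intros)
    then have "E (S' y) \<le> (1 + 0) * F y"
      by (rule LIMSEQ_le[OF contE[OF limS[OF tendsto_const]]]) (use ES in blast)
    then show ?thesis by simp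
  qed
  have "F (T' x) = E x" for x
    using FT'[of x] ES'[of "T' x"] ST'[of x] by simp
  moreover have "bij T'"
    by (rule o_bij[of S']) (auto simp: TS' ST')
  moreover have "linear T'"
    unfolding T'_def by (simp add: blinfun.bounded_linear_right bounded_linear.linear)
  ultimately show ?thesis unfolding isometric_def by blast
qed

lemma banach_mazur_eq_1_iff:
  assumes "normed_plane E" "normed_plane F"
  shows "banach_mazur E F = 1 \<longleftrightarrow> isometric E F"
proof
  assume eq: "banach_mazur E F = 1"
  obtain M N :: "real^2 \<Rightarrow> real" where MN: "normed_plane M" "isometric M E" "normed_plane N" "isometric N F"
    using normed_plane_coordinates assms by metis
  then have "banach_mazur M N = 1"
    using banach_mazur_cong[OF MN(1) assms(1) MN(3) assms(2) MN(2,4)] eq by simp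
  then have "isometric M N"
    using MN banach_mazur_1_imp_isometric_aux by blast
  then show "isometric E F"
    using MN isometric_sym isometric_trans by metis
qed (use assms banach_mazur_isometric in blast)


section \<open>The metric space \<open>BM\<^sub>2\<close>\<close>

text \<open>Every two-dimensional normed space is isometric to one whose underlying vector space is
  \<open>\<real>\<^sup>2\<close>, so its isometry class is represented by the set of all norms on \<open>\<real>\<^sup>2\<close> isometric to it.\<close>

definition isometry_class :: "('a::real_vector \<Rightarrow> real) \<Rightarrow> (real^2 \<Rightarrow> real) set" where
  "isometry_class E = {N. normed_plane N \<and> isometric N E}"

typedef BM2 = "{isometry_class E | E :: real^2 \<Rightarrow> real. normed_plane E}"
  using normed_plane_norm by blast

definition BM2_of :: "('a::real_vector \<Rightarrow> real) \<Rightarrow> BM2" where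
  "BM2_of E = Abs_BM2 (isometry_class E)"

lemma isometry_class_eq:
  assumes "isometric E F" shows "isometry_class E = isometry_class F"
  unfolding isometry_class_def
  using isometric_trans[OF _ assms] isometric_trans[OF _ isometric_sym[OF assms]] by auto

lemma Rep_BM2_of:
  assumes "normed_plane E" shows "Rep_BM2 (BM2_of E) = isometry_class E"
proof -
  obtain N :: "real^2 \<Rightarrow> real" where "normed_plane N" "isometric N E"
    using normed_plane_coordinates[OF assms] by blast
  then show ?thesis
    unfolding BM2_of_def using isometry_class_eq[of N E] by (intro Abs_BM2_inverse) auto
qed

lemma BM2_of_eq_iff:
  assumes "normed_plane E" "normed_plane F"
  shows "BM2_of E = BM2_of F \<longleftrightarrow> isometric E F"
proof
  assume "BM2_of E = BM2_of F"
  then have "isometry_class E = isometry_class F"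
    using Rep_BM2_of assms by metis
  moreover obtain N :: "real^2 \<Rightarrow> real" where N: "normed_plane N" "isometric N E"
    using normed_plane_coordinates[OF assms(1)] by blast
  ultimately have "isometric N F"
    unfolding isometry_class_def by blast
  then show "isometric E F"
    by (rule isometric_trans[OF isometric_sym[OF N(2)]])
qed (simp add: BM2_of_def isometry_class_eq)

lemma BM2_cases:
  obtains N :: "real^2 \<Rightarrow> real" where "normed_plane N" "X = BM2_of N"
  by (cases X rule: Abs_BM2_cases) (auto simp: BM2_of_def)

instantiation BM2 :: metric_space
begin

definition dist_BM2 :: "BM2 \<Rightarrow> BM2 \<Rightarrow> real" where
  "dist_BM2 X Y = ln (banach_mazur (SOME N. N \<in> Rep_BM2 X) (SOME N. N \<in> Rep_BM2 Y))"

definition uniformity_BM2 :: "(BM2 \<times> BM2) filter" where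
  "uniformity_BM2 = (INF e\<in>{0<..}. principal {(x, y). dist x y < e})"

definition open_BM2 :: "BM2 set \<Rightarrow> bool" where
  "open_BM2 U = (\<forall>x\<in>U. \<forall>\<^sub>F (x', y) in uniformity. x' = x \<longrightarrow> y \<in> U)"

lemma dist_BM2_of:
  assumes "normed_plane E" "normed_plane F"
  shows "dist (BM2_of E) (BM2_of F) = ln (banach_mazur E F)"
proof -
  have *: "normed_plane (SOME N. N \<in> Rep_BM2 (BM2_of G)) \<and> isometric (SOME N. N \<in> Rep_BM2 (BM2_of G)) G"
    if "normed_plane G" for G :: "'c::real_vector \<Rightarrow> real"
    using someI_ex[of "\<lambda>N. N \<in> Rep_BM2 (BM2_of G)"] normed_plane_coordinates[OF that]
    by (simp add: Rep_BM2_of[OF that] isometry_class_def)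
  show ?thesis
    unfolding dist_BM2_def
    using banach_mazur_cong *[OF assms(1)] *[OF assms(2)] assms by metis
qed

instance
proof
  fix X Y Z :: BM2
  obtain E F G :: "real^2 \<Rightarrow> real" where E: "normed_plane E" "X = BM2_of E"
    and F: "normed_plane F" "Y = BM2_of F" and G: "normed_plane G" "Z = BM2_of G"
    by (metis BM2_cases)
  show "dist X Y = 0 \<longleftrightarrow> X = Y"
    using E F banach_mazur_ge_1[OF E(1) F(1)]
    by (simp add: dist_BM2_of BM2_of_eq_iff flip: banach_mazur_eq_1_iff)
  have ge: "1 \<le> banach_mazur E F" "1 \<le> banach_mazur E G" "1 \<le> banach_mazur F G"
    using E F G banach_mazur_ge_1 by blast+
  have "ln (banach_mazur E F) \<le> ln (banach_mazur E G * banach_mazur G F)"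
    using banach_mazur_triangle[OF E(1) G(1) F(1)] ge by simp
  also have "\<dots> = ln (banach_mazur E G) + ln (banach_mazur F G)"
    using ge banach_mazur_sym[OF G(1) F(1)] by (simp add: ln_mult)
  finally show "dist X Y \<le> dist X Z + dist Y Z"
    using E F G by (simp add: dist_BM2_of)
qed (simp_all add: uniformity_BM2_def open_BM2_def)

end


section \<open>Geodesics\<close>

definition path_length :: "(real \<Rightarrow> 'm::metric_space) \<Rightarrow> real \<Rightarrow> real \<Rightarrow> ereal" where
  "path_length \<gamma> a b =
     (SUP (m, t) \<in> {(m, t :: nat \<Rightarrow> real). t 0 = a \<and> t m = b \<and> (\<forall>i<m. t i \<le> t (Suc i))}.
        ereal (\<Sum>i = 1..m. dist (\<gamma> (t i)) (\<gamma> (t (i - 1)))))"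

definition geodesic :: "(real \<Rightarrow> 'm::metric_space) \<Rightarrow> real \<Rightarrow> real \<Rightarrow> 'm \<Rightarrow> 'm \<Rightarrow> bool" where
  "geodesic \<gamma> a b x y \<longleftrightarrow>
     a \<le> b \<and> continuous_on {a..b} \<gamma> \<and> \<gamma> a = x \<and> \<gamma> b = y \<and> path_length \<gamma> a b = ereal (dist x y)"

end

theory Submission
  imports Defs
begin

text \<open>By compactness we may take both norms on the same plane with \<open>E \<le> F \<le> s\<^sup>2 E\<close>, where
  \<open>s\<^sup>2\<close> is the Banach-Mazur distance. Every norm \<open>G\<close> with
  \<open>max E (F / s) \<le> G \<le> min F (s E)\<close> is at distance \<open>ln s\<close> from both ends and lies on a geodesic,
  of which it is the only point at distance \<open>ln s\<close> from \<open>E\<close>. So it suffices that these norms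
  fall into uncountably many isometry classes.

  By optimality and continuity \<open>F u = s E u\<close> for some \<open>u \<noteq> 0\<close>. There the largest norm below
  \<open>min F (s E)\<close> strictly exceeds \<open>max E (F / s)\<close>, which leaves room to prescribe the
  values of \<open>G\<close> at five points near \<open>u\<close> independently: the value vectors fill a box in \<open>\<real>\<^sup>5\<close>.
  The norms isometric to a fixed one are parametrised by \<open>2 \<times> 2\<close> matrices, and their value
  vectors form a Lipschitz image of a subset of \<open>\<real>\<^sup>4\<close>, a null set. Countably many null sets
  do not cover the box.\<close>

section \<open>Maxima and positive multiples of norms\<close>

lemma normed_plane_max:
  assumes "normed_plane E" "normed_plane F"
  shows "normed_plane (\<lambda>x. max (E x) (F x))"
  unfolding normed_plane_def
proof (intro conjI allI)
  show "dim (UNIV :: 'a set) = 2" using assms(1) by (simp add: normed_plane_def)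
  show "max (E x) (F x) = 0 \<longleftrightarrow> x = 0" for x
    using normed_plane_nonneg[OF assms(1), of x] normed_plane_nonneg[OF assms(2), of x]
      normed_plane_eq_0[OF assms(1), of x] normed_plane_eq_0[OF assms(2), of x] by linarith
  show "max (E (c *\<^sub>R x)) (F (c *\<^sub>R x)) = \<bar>c\<bar> * max (E x) (F x)" for c x
    by (simp add: normed_plane_scale[OF assms(1)] normed_plane_scale[OF assms(2)] max_mult_distrib_left)
  show "max (E (x + y)) (F (x + y)) \<le> max (E x) (F x) + max (E y) (F y)" for x y
    using normed_plane_add[OF assms(1), of x y] normed_plane_add[OF assms(2), of x y] by linarith
qed

lemma normed_plane_cmult:
  assumes "normed_plane E" "0 < c"
  shows "normed_plane (\<lambda>x. c * E x)"
  using assms normed_plane_add[OF assms(1)]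
  by (auto simp: normed_plane_def mult.left_commute simp flip: distrib_left)

text \<open>A functional alone gives only a seminorm, vanishing on a line; the maximum with
  \<open>E\<close> restores definiteness.\<close>

lemma normed_plane_max_functional:
  fixes a :: "'a::euclidean_space"
  assumes "normed_plane E" "0 \<le> c"
  shows "normed_plane (\<lambda>x. max (E x) (c * \<bar>a \<bullet> x\<bar>))"
  unfolding normed_plane_def
proof (intro conjI allI)
  show "dim (UNIV :: 'a set) = 2" using assms(1) by (simp add: normed_plane_def)
  show "max (E x) (c * \<bar>a \<bullet> x\<bar>) = 0 \<longleftrightarrow> x = 0" for x
    using normed_plane_pos[OF assms(1), of x] normed_plane_zero[OF assms(1)] by (cases "x = 0") auto
  show "max (E (r *\<^sub>R x)) (c * \<bar>a \<bullet> (r *\<^sub>R x)\<bar>) = \<bar>r\<bar> * max (E x) (c * \<bar>a \<bullet> x\<bar>)" for r x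
    by (simp add: normed_plane_scale[OF assms(1)] max_mult_distrib_left abs_mult mult.left_commute)
  fix x y
  have "c * \<bar>a \<bullet> (x + y)\<bar> \<le> c * \<bar>a \<bullet> x\<bar> + c * \<bar>a \<bullet> y\<bar>"
    using assms(2) by (auto simp: inner_add_right simp flip: distrib_left intro!: mult_left_mono)
  then show "max (E (x + y)) (c * \<bar>a \<bullet> (x + y)\<bar>) \<le> max (E x) (c * \<bar>a \<bullet> x\<bar>) + max (E y) (c * \<bar>a \<bullet> y\<bar>)"
    using normed_plane_add[OF assms(1), of x y] by linarith
qed

lemma normed_plane_Max:
  fixes N :: "'i::finite \<Rightarrow> 'a::real_vector \<Rightarrow> real"
  assumes "\<And>i. normed_plane (N i)"
  shows "normed_plane (\<lambda>x. Max (range (\<lambda>i. N i x)))"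
  unfolding normed_plane_def
proof (intro conjI allI)
  have ge: "N i x \<le> Max (range (\<lambda>i. N i x))" for i x by (rule Max_ge) auto
  show "dim (UNIV :: 'a set) = 2" using assms by (simp add: normed_plane_def)
  show "Max (range (\<lambda>i. N i x)) = 0 \<longleftrightarrow> x = 0" for x
  proof (cases "x = 0")
    case False
    then show ?thesis
      using normed_plane_pos[OF assms, of x undefined] ge[of undefined x] by linarith
  qed (simp add: normed_plane_zero[OF assms])
  show "Max (range (\<lambda>i. N i (c *\<^sub>R x))) = \<bar>c\<bar> * Max (range (\<lambda>i. N i x))" for c x
  proof -
    have "mono (\<lambda>y. \<bar>c\<bar> * y)" by (auto intro!: monoI mult_left_mono)
    then have "\<bar>c\<bar> * Max (range (\<lambda>i. N i x)) = Max ((\<lambda>y. \<bar>c\<bar> * y) ` range (\<lambda>i. N i x))"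
      by (rule mono_Max_commute) auto
    then show ?thesis by (simp add: image_image normed_plane_scale[OF assms])
  qed
  show "Max (range (\<lambda>i. N i (x + y))) \<le> Max (range (\<lambda>i. N i x)) + Max (range (\<lambda>i. N i y))" for x y
  proof (rule Max.boundedI)
    fix r assume "r \<in> range (\<lambda>i. N i (x + y))"
    then obtain i where "r = N i (x + y)" by auto
    then show "r \<le> Max (range (\<lambda>i. N i x)) + Max (range (\<lambda>i. N i y))"
      using normed_plane_add[OF assms, of i x y] ge[of i x] ge[of i y] by linarith
  qed auto
qed

section \<open>Bounding and attaining the Banach-Mazur distance\<close>

text \<open>The identity serves as test isomorphism: its norm is at most \<open>c\<close>, that of
  its inverse at most \<open>1 / m\<close>.\<close>

lemma banach_mazur_le:
  assumes "normed_plane E" "normed_plane F" "0 < m"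
    and "\<And>x. m * E x \<le> F x" "\<And>x. F x \<le> c * E x" "0 \<le> c"
  shows "banach_mazur E F \<le> c / m"
proof -
  have "op_norm E F id \<le> c" using assms by (intro op_norm_least) auto
  moreover have "op_norm F E (inv id) \<le> 1 / m"
    using assms by (intro op_norm_least) (auto simp: field_simps)
  moreover have "0 \<le> op_norm F E (inv id)"
    using assms by (intro op_norm_nonneg linear_inv_bij linear_id) auto
  ultimately have "op_norm E F id * op_norm F E (inv id) \<le> c * (1 / m)"
    using assms(6) by (intro mult_mono) auto
  then show ?thesis
    using banach_mazur_lower[OF assms(1,2) linear_id bij_id] by simp
qed

text \<open>Near-optimal isomorphisms, scaled so that the lower bound is exact, form a bounded
  sequence in a finite-dimensional operator space. A subsequence converges, both bounds pass to the
  limit, and the lower one makes the limit injective.\<close>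

lemma banach_mazur_attained:
  fixes E F :: "real^2 \<Rightarrow> real"
  assumes E: "normed_plane E" and F: "normed_plane F"
  shows "\<exists>T. linear T \<and> bij T \<and> (\<forall>x. E x \<le> F (T x)) \<and> (\<forall>x. F (T x) \<le> banach_mazur E F * E x)"
proof -
  let ?d = "banach_mazur E F"
  have "\<exists>T. linear T \<and> (\<forall>x. E x \<le> F (T x)) \<and> (\<forall>x. F (T x) \<le> (?d + inverse (real (Suc n))) * E x)" for n
  proof -
    have "?d < ?d + inverse (real (Suc n))" by simp
    then obtain T where T: "linear T" "bij T"
      and less: "op_norm E F T * op_norm F E (inv T) < ?d + inverse (real (Suc n))"
      using banach_mazur_greatest[OF E F, of "?d + inverse (real (Suc n))"] by (meson not_less)
    note lin = linear_inv_bij[OF T]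
    \<comment> \<open>Scaling \<open>T\<close> by the norm of its inverse moves the whole distortion
      into the upper bound.\<close>
    let ?r = "op_norm F E (inv T)"
    have r: "0 < ?r"
      using op_norm_inv_ge_1[OF E F T] op_norm_nonneg[OF F E lin]
      by (metis less_eq_real_def mult_zero_right not_one_le_zero)
    have "E x \<le> ?r * F (T x)" for x
      using op_norm_bound[OF F E lin, of "T x"] T(2) by (simp add: bij_is_inj)
    moreover have "?r * F (T x) \<le> (?d + inverse (real (Suc n))) * E x" for x
    proof -
      have "?r * F (T x) \<le> ?r * (op_norm E F T * E x)"
        using r by (intro mult_left_mono op_norm_bound[OF E F T(1)]) auto
      also have "\<dots> = (op_norm E F T * ?r) * E x" by simp
      also have "\<dots> \<le> (?d + inverse (real (Suc n))) * E x"
        using less normed_plane_nonneg[OF E] by (intro mult_right_mono) auto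
      finally show ?thesis .
    qed
    ultimately show ?thesis
      using T(1) r
      by (intro exI[of _ "\<lambda>x. ?r *\<^sub>R T x"])
        (simp add: linear_compose_scale_right normed_plane_scale[OF F])
  qed
  then obtain T where lT: "\<And>n. linear (T n)" and lo: "\<And>n x. E x \<le> F (T n x)"
    and up: "\<And>n x. F (T n x) \<le> (?d + inverse (real (Suc n))) * E x"
    by metis
  obtain C where C: "C > 0" "\<And>x. norm x \<le> C * F x" using normed_plane_lower[OF F] by blast
  obtain D where D: "D > 0" "\<And>x. E x \<le> D * norm x" using normed_plane_upper[OF E] by blast
  have d: "1 \<le> ?d" by (rule banach_mazur_ge_1[OF E F])
  have ap: "blinfun_apply (Blinfun (T n)) = T n" for n
    using lT by (auto intro!: bounded_linear_Blinfun_apply simp: linear_conv_bounded_linear)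
  have "norm (Blinfun (T n)) \<le> C * ((?d + 1) * D)" for n
  proof (rule norm_blinfun_bound)
    show "0 \<le> C * ((?d + 1) * D)" using C D d by simp
    fix x
    have "norm (T n x) \<le> C * F (T n x)" by (rule C)
    also have "\<dots> \<le> C * ((?d + inverse (real (Suc n))) * E x)"
      using C up by (intro mult_left_mono) auto
    also have "\<dots> \<le> C * ((?d + 1) * (D * norm x))"
      using C D d normed_plane_nonneg[OF E]
      by (intro mult_left_mono mult_mono) (auto simp: field_simps)
    finally show "norm (Blinfun (T n) x) \<le> C * ((?d + 1) * D) * norm x" by (simp add: ap mult.assoc)
  qed
  then have "bounded (range (\<lambda>n. Blinfun (T n)))"
    by (intro boundedI[of _ "C * ((?d + 1) * D)"]) auto
  then obtain l r where r: "strict_mono (r :: nat \<Rightarrow> nat)"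
    and lim: "((\<lambda>n. Blinfun (T n)) \<circ> r) \<longlonglongrightarrow> l"
    using bounded_imp_convergent_subsequence by blast
  have "(\<lambda>n. blinfun_apply (((\<lambda>n. Blinfun (T n)) \<circ> r) n) x) \<longlonglongrightarrow> blinfun_apply l x" for x
    by (intro tendsto_intros lim)
  then have limT: "(\<lambda>n. T (r n) x) \<longlonglongrightarrow> l x" for x by (simp add: ap)
  have limF: "(\<lambda>n. F (T (r n) x)) \<longlonglongrightarrow> F (l x)" for x
    using continuous_on_tendsto_compose[OF normed_plane_continuous[OF F, of UNIV] limT] by simp
  have 1: "E x \<le> F (l x)" for x
    by (rule LIMSEQ_le_const[OF limF]) (use lo in blast)
  have 2: "F (l x) \<le> ?d * E x" for x
  proof -
    have "(\<lambda>n. inverse (real (Suc (r n)))) \<longlonglongrightarrow> 0"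
      using LIMSEQ_subseq_LIMSEQ[OF LIMSEQ_inverse_real_of_nat r] by (simp add: o_def)
    then have "(\<lambda>n. (?d + inverse (real (Suc (r n)))) * E x) \<longlonglongrightarrow> (?d + 0) * E x"
      by (intro tendsto_intros)
    then have "F (l x) \<le> (?d + 0) * E x"
      by (rule LIMSEQ_le[OF limF]) (use up in blast)
    then show ?thesis by simp
  qed
  have lin: "linear (blinfun_apply l)"
    by (simp add: blinfun.bounded_linear_right bounded_linear.linear)
  have "x = 0" if "blinfun_apply l x = 0" for x
    using 1[of x] that normed_plane_zero[OF F] normed_plane_pos[OF E, of x] by fastforce
  then have "inj (blinfun_apply l)" using linear_injective_0[OF lin] by blast
  then have "bij (blinfun_apply l)"
    using linear_injective_imp_surjective[OF lin] by (simp add: bij_def)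
  then show ?thesis using lin 1 2 by blast
qed

lemma BM2_dist_le:
  assumes "normed_plane E" "normed_plane F" "\<And>x. E x \<le> F x" "\<And>x. F x \<le> exp r * E x"
  shows "dist (BM2_of E) (BM2_of F) \<le> r"
proof -
  have "banach_mazur E F \<le> exp r / 1" using assms by (intro banach_mazur_le) auto
  then have "ln (banach_mazur E F) \<le> ln (exp r)"
    using banach_mazur_ge_1[OF assms(1,2)] by (subst ln_le_cancel_iff) auto
  then show ?thesis by (simp add: dist_BM2_of assms)
qed

section \<open>Geodesics through an intermediate norm\<close>

text \<open>Telescoping bounds every partition sum by \<open>b - a\<close>, and the partition into a
  single interval attains this.\<close>

lemma geodesic_of_nonexpansive:
  fixes \<gamma> :: "real \<Rightarrow> 'm::metric_space"
  assumes "a \<le> b"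
    and lip: "\<And>s t. a \<le> s \<Longrightarrow> s \<le> t \<Longrightarrow> t \<le> b \<Longrightarrow> dist (\<gamma> s) (\<gamma> t) \<le> t - s"
    and ends: "dist (\<gamma> a) (\<gamma> b) = b - a"
  shows "geodesic \<gamma> a b (\<gamma> a) (\<gamma> b)"
proof -
  have "dist (\<gamma> s) (\<gamma> t) \<le> 1 * dist s t" if "s \<in> {a..b}" "t \<in> {a..b}" for s t
    using lip[of s t] lip[of t s] that by (cases "s \<le> t") (auto simp: dist_real_def dist_commute)
  then have "1-lipschitz_on {a..b} \<gamma>" by (auto simp: lipschitz_on_def)
  then have cont: "continuous_on {a..b} \<gamma>" by (rule lipschitz_on_continuous_on)
  have "path_length \<gamma> a b = ereal (b - a)"
  proof (rule antisym)
    show "path_length \<gamma> a b \<le> ereal (b - a)"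
      unfolding path_length_def
    proof (rule SUP_least, clarify)
      fix m and t :: "nat \<Rightarrow> real"
      assume t: "a = t 0" "b = t m" "\<forall>i<m. t i \<le> t (Suc i)"
      have mono: "t i \<le> t j" if "i \<le> j" "j \<le> m" for i j
        using that
      proof (induction rule: dec_induct)
        case (step n)
        then have "t n \<le> t (Suc n)" using t(3) by simp
        then show ?case using step by simp
      qed simp
      have "(\<Sum>i = 1..m. dist (\<gamma> (t i)) (\<gamma> (t (i - 1)))) \<le> (\<Sum>i = 1..m. t i - t (i - 1))"
      proof (rule sum_mono)
        fix i assume "i \<in> {1..m}"
        then show "dist (\<gamma> (t i)) (\<gamma> (t (i - 1))) \<le> t i - t (i - 1)"
          using lip[of "t (i - 1)" "t i"] mono[of 0 "i - 1"] mono[of "i - 1" i] mono[of i m] t(1,2)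
          by (auto simp: dist_commute)
      qed
      also have "\<dots> = t m - t 0"
        by (induction m) auto
      finally show "ereal (\<Sum>i = 1..m. dist (\<gamma> (t i)) (\<gamma> (t (i - 1)))) \<le> ereal (t m - t 0)"
        by simp
    qed
    show "ereal (b - a) \<le> path_length \<gamma> a b"
      unfolding path_length_def
      by (rule SUP_upper2[of "(1, \<lambda>i. if i = 0 then a else b)"])
        (use assms(1) ends in \<open>auto simp: dist_commute\<close>)
  qed
  then show ?thesis
    using assms(1) cont ends by (simp add: geodesic_def)
qed

text \<open>The second conjunct lets the class of \<open>G\<close> be read off the image of the
  geodesic, so distinct classes yield distinct images.\<close>

lemma geodesic_through_intermediate_norm:
  fixes E F G :: "real^2 \<Rightarrow> real"
  assumes E: "normed_plane E" and F: "normed_plane F" and G: "normed_plane G"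
    and s: "1 < s" and bm: "banach_mazur E F = s\<^sup>2"
    and EG: "\<And>x. E x \<le> G x" "\<And>x. G x \<le> s * E x"
    and GF: "\<And>x. G x \<le> F x" "\<And>x. F x \<le> s * G x"
  shows "\<exists>\<gamma> a b. geodesic \<gamma> a b (BM2_of E) (BM2_of F) \<and>
           \<gamma> ` {a..b} \<inter> {X. dist (BM2_of E) X = ln s} = {BM2_of G}"
proof -
  \<comment> \<open>The factors make the curve run from \<open>E\<close> at time 0 through
    \<open>G\<close> at \<open>ln s\<close> to \<open>F\<close> at \<open>2 * ln s\<close>. The cap
    1 on the coefficient of \<open>G\<close> keeps the norm from exceeding \<open>F\<close> at the
    end.\<close>
  define N where "N t x = max (E x) (max (min 1 (exp t / s) * G x) (exp t / s\<^sup>2 * F x))" for t x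
  define \<gamma> where "\<gamma> t = BM2_of (N t)" for t
  have N: "normed_plane (N t)" for t
    unfolding N_def using s by (intro normed_plane_max normed_plane_cmult E F G) auto
  note pos = normed_plane_nonneg[OF E] normed_plane_nonneg[OF F] normed_plane_nonneg[OF G]
  have lip: "dist (\<gamma> t) (\<gamma> t') \<le> t' - t" if "t \<le> t'" for t t'
    unfolding \<gamma>_def
  proof (rule BM2_dist_le[OF N N])
    fix x
    have e: "exp t' = exp (t' - t) * exp t" by (simp flip: exp_add)
    have e1: "1 \<le> exp (t' - t)" using that by simp
    have "min 1 (exp t / s) \<le> min 1 (exp t' / s)"
      using s that by (intro min.mono divide_right_mono) auto
    then show "N t x \<le> N t' x"
      unfolding N_def using that s pos by (intro max.mono mult_right_mono divide_right_mono) auto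
    have "min 1 (exp t' / s) \<le> exp (t' - t) * min 1 (exp t / s)"
    proof -
      have "exp (t' - t) * min 1 (exp t / s) = min (exp (t' - t)) (exp t' / s)"
        by (simp add: min_mult_distrib_left e)
      then show ?thesis using e1 by (simp add: min.coboundedI1)
    qed
    then have 1: "min 1 (exp t' / s) * G x \<le> exp (t' - t) * (min 1 (exp t / s) * G x)"
      using pos by (simp add: mult_right_mono flip: mult.assoc)
    have 2: "E x \<le> exp (t' - t) * E x"
      using mult_right_mono[OF e1 pos(1)[of x]] by simp
    have 3: "exp t' / s\<^sup>2 * F x \<le> exp (t' - t) * (exp t / s\<^sup>2 * F x)"
      by (simp add: e)
    have "exp (t' - t) * N t x = max (exp (t' - t) * E x)
        (max (exp (t' - t) * (min 1 (exp t / s) * G x)) (exp (t' - t) * (exp t / s\<^sup>2 * F x)))"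
      unfolding N_def by (simp add: max_mult_distrib_left)
    also have "N t' x \<le> \<dots>"
      unfolding N_def by (intro max.mono 1 2 3)
    finally show "N t' x \<le> exp (t' - t) * N t x" .
  qed
  have "N 0 x = E x" for x
  proof -
    have "F x \<le> s * (s * E x)" using order_trans[OF GF(2)[of x] mult_left_mono[OF EG(2)[of x]]] s by simp
    then show ?thesis using s EG(2)[of x] by (simp add: N_def min_def max_def field_simps power2_eq_square)
  qed
  then have "N 0 = E" by (rule ext)
  then have N0: "\<gamma> 0 = BM2_of E" by (simp add: \<gamma>_def)
  have "N (ln s) x = G x" for x
  proof -
    have "s / s\<^sup>2 * F x \<le> G x"
      using s GF(2)[of x] by (simp add: power2_eq_square divide_le_eq mult.commute)
    then show ?thesis using s EG(1)[of x] by (simp add: N_def max_def)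
  qed
  then have "N (ln s) = G" by (rule ext)
  then have Ns: "\<gamma> (ln s) = BM2_of G" by (simp add: \<gamma>_def)
  have "exp (2 * ln s) = s\<^sup>2" using s by (simp add: exp_double)
  then have "N (2 * ln s) x = F x" for x
    using s EG(1)[of x] GF(1)[of x] by (simp add: N_def max_def min_def field_simps power2_eq_square)
  then have "N (2 * ln s) = F" by (rule ext)
  then have N1: "\<gamma> (2 * ln s) = BM2_of F" by (simp add: \<gamma>_def)
  have ends: "dist (\<gamma> 0) (\<gamma> (2 * ln s)) = 2 * ln s"
    using s by (simp add: N0 N1 dist_BM2_of E F bm ln_realpow)
  \<comment> \<open>The distances from \<open>\<gamma> t\<close> to the two ends are at most
    \<open>t\<close> and \<open>2 * ln s - t\<close>, and these add up to the distance of the ends,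
    so the first bound is an equality. Hence the curve meets the sphere of radius
    \<open>ln s\<close> only at time \<open>ln s\<close>.\<close>
  have "dist (\<gamma> 0) (\<gamma> t) = t" if "0 \<le> t" "t \<le> 2 * ln s" for t
    using lip[of 0 t] lip[of t "2 * ln s"] dist_triangle[of "\<gamma> 0" "\<gamma> (2 * ln s)" "\<gamma> t"] that ends
    by linarith
  then have "\<gamma> ` {0..2 * ln s} \<inter> {X. dist (\<gamma> 0) X = ln s} = {\<gamma> (ln s)}"
    using s by auto
  moreover have "geodesic \<gamma> 0 (2 * ln s) (\<gamma> 0) (\<gamma> (2 * ln s))"
    using s lip ends by (intro geodesic_of_nonexpansive) auto
  ultimately show ?thesis
    unfolding N0 N1 Ns by blast
qed

section \<open>Separation by a functional below two norms\<close>

text \<open>The largest norm below \<open>P\<close> and \<open>Q\<close> takes at \<open>u\<close>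
  the infimum of \<open>P p + Q (u - p)\<close>. The assumption puts \<open>u\<close> outside a
  convex sublevel set of this norm, and a separating hyperplane gives the functional.\<close>

lemma ex_functional_below_two_norms:
  fixes P Q :: "real^2 \<Rightarrow> real"
  assumes P: "normed_plane P" and Q: "normed_plane Q" and c: "0 < c"
    and u: "\<And>p. c < P p + Q (u - p)"
  shows "\<exists>a. (\<forall>x. a \<bullet> x \<le> P x) \<and> (\<forall>x. a \<bullet> x \<le> Q x) \<and> c \<le> a \<bullet> u"
proof -
  \<comment> \<open>Sublevel set at \<open>c\<close> of that largest norm. Taking
    \<open>p = x\<close> and \<open>p = 0\<close> shows that it contains the balls of radius
    \<open>c\<close> of \<open>P\<close> and \<open>Q\<close>.\<close>
  define S where "S = {x. \<exists>p. P p + Q (x - p) \<le> c}"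
  have "convex S"
  proof (rule convexI)
    fix x y and l m :: real assume "x \<in> S" "y \<in> S" and lm: "0 \<le> l" "0 \<le> m" "l + m = 1"
    then obtain p q where pq: "P p + Q (x - p) \<le> c" "P q + Q (y - q) \<le> c" by (auto simp: S_def)
    have e: "l *\<^sub>R x + m *\<^sub>R y - (l *\<^sub>R p + m *\<^sub>R q) = l *\<^sub>R (x - p) + m *\<^sub>R (y - q)"
      by (simp add: algebra_simps)
    have "P (l *\<^sub>R p + m *\<^sub>R q) \<le> l * P p + m * P q"
      using normed_plane_add[OF P, of "l *\<^sub>R p" "m *\<^sub>R q"] lm by (simp add: normed_plane_scale[OF P])
    moreover have "Q (l *\<^sub>R (x - p) + m *\<^sub>R (y - q)) \<le> l * Q (x - p) + m * Q (y - q)"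
      using normed_plane_add[OF Q, of "l *\<^sub>R (x - p)" "m *\<^sub>R (y - q)"] lm by (simp add: normed_plane_scale[OF Q])
    moreover have "l * (P p + Q (x - p)) + m * (P q + Q (y - q)) \<le> l * c + m * c"
      using pq lm by (intro add_mono mult_left_mono) auto
    moreover have "l * c + m * c = c" using lm by (simp flip: distrib_right)
    ultimately have "P (l *\<^sub>R p + m *\<^sub>R q) + Q (l *\<^sub>R x + m *\<^sub>R y - (l *\<^sub>R p + m *\<^sub>R q)) \<le> c"
      unfolding e by (simp add: distrib_left)
    then show "l *\<^sub>R x + m *\<^sub>R y \<in> S" unfolding S_def by blast
  qed
  moreover have SP: "x \<in> S" if "P x \<le> c" for x
    using that normed_plane_zero[OF Q] by (auto simp: S_def intro!: exI[of _ x])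
  moreover have SQ: "x \<in> S" if "Q x \<le> c" for x
    using that normed_plane_zero[OF P] by (auto simp: S_def intro!: exI[of _ 0])
  moreover have "S \<noteq> {}" using SP[of 0] c normed_plane_zero[OF P] by auto
  moreover have "S \<inter> {u} = {}" using u by (auto simp: S_def not_le)
  ultimately obtain a b where a: "a \<noteq> 0" and "\<forall>x\<in>S. a \<bullet> x \<le> b" and b: "b \<le> a \<bullet> u"
    using separating_hyperplane_sets[of S "{u}"] by auto
  then have S: "a \<bullet> x \<le> b" if "x \<in> S" for x using that by blast
  \<comment> \<open>By homogeneity the bound \<open>b\<close> on the ball of radius \<open>c\<close>
    of \<open>R\<close> extends to all \<open>x\<close>; rescaling \<open>a\<close> by
    \<open>c / b\<close> then gives the functional, once \<open>b\<close> is known to be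
    positive.\<close>
  have bound: "c * (a \<bullet> x) \<le> b * R x" if "normed_plane R" "\<And>x. R x \<le> c \<Longrightarrow> x \<in> S" for R x
  proof (cases "x = 0")
    case False
    then have R: "0 < R x" using normed_plane_pos that(1) by blast
    then have "R ((c / R x) *\<^sub>R x) \<le> c" using c by (simp add: normed_plane_scale[OF that(1)])
    then have "a \<bullet> ((c / R x) *\<^sub>R x) \<le> b" using that(2) S by blast
    then show ?thesis using R by (simp add: field_simps)
  qed (use normed_plane_zero[OF that(1)] in simp)
  have "0 < b"
  proof -
    have "0 < c * (a \<bullet> a)" using a c by simp
    also have "\<dots> \<le> b * P a" using bound[OF P SP] .
    finally show ?thesis using normed_plane_pos[OF P a] by (simp add: zero_less_mult_iff)
  qed
  then show ?thesis
    using bound[OF P SP] bound[OF Q SQ] b c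
    by (intro exI[of _ "(c / b) *\<^sub>R a"]) (auto simp: field_simps)
qed

section \<open>Null and non-null sets of value vectors in five dimensions\<close>

text \<open>A linear map of the plane has four matrix entries and the five values are Lipschitz in
  them, so they sweep out a null set.\<close>

lemma negligible_values_of_isometric_copies:
  fixes N :: "real^2 \<Rightarrow> real" and x :: "5 \<Rightarrow> real^2"
  assumes N: "normed_plane N"
  shows "negligible {\<chi> i. N (T (x i)) | T. linear T}"
proof -
  \<comment> \<open>Coordinates 1 to 4 hold the matrix entries row by row. The fifth, index 0 in the
    type \<open>5\<close>, is later set to 0: the matrices then form a null hyperplane of
    \<open>real^5\<close>, and Lipschitz maps of \<open>real^5\<close> to itself preserve null
    sets.\<close>
  define A :: "real^5 \<Rightarrow> real^2 \<Rightarrow> real^2" where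
    "A v y = vector [v $ 1 * y $ 1 + v $ 2 * y $ 2, v $ 3 * y $ 1 + v $ 4 * y $ 2]" for v y
  define f where "f v = (\<chi> i. N (A v (x i)))" for v :: "real^5"
  obtain C where C: "C > 0" "\<And>y. N y \<le> C * norm y" using normed_plane_upper[OF N] by blast
  have A_norm: "norm (A v y) \<le> 4 * norm v * norm y" for v y
  proof -
    have m: "\<bar>v $ i * y $ j\<bar> \<le> norm v * norm y" for i j
      unfolding abs_mult by (intro mult_mono component_le_norm_cart) auto
    have "norm (A v y) \<le> \<bar>A v y $ 1\<bar> + \<bar>A v y $ 2\<bar>"
      using norm_le_l1_cart[of "A v y"] by (simp add: sum_2)
    then show ?thesis
      using m[of 1 1] m[of 2 2] m[of 3 1] m[of 4 2] unfolding A_def vector_2 by linarith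
  qed
  have A_diff: "A (v - w) y = A v y - A w y" for v w y
    by (simp add: A_def vec_eq_iff forall_2 algebra_simps)
  have lip: "norm (f v - f w) \<le> (\<Sum>i\<in>UNIV. C * (4 * norm (x i))) * norm (v - w)" for v w
  proof -
    have "\<bar>N (A v y) - N (A w y)\<bar> \<le> C * (4 * norm y) * norm (v - w)" for y
    proof -
      have "\<bar>N (A v y) - N (A w y)\<bar> \<le> N (A v y - A w y)"
        using normed_plane_add[OF N, of "A v y - A w y" "A w y"]
          normed_plane_add[OF N, of "A w y - A v y" "A v y"]
          normed_plane_minus[OF N, of "A v y - A w y"] by simp
      also have "\<dots> \<le> C * norm (A (v - w) y)" using C(2) by (simp add: A_diff)
      also have "\<dots> \<le> C * (4 * norm (v - w) * norm y)" using C(1) A_norm by (intro mult_left_mono) auto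
      finally show ?thesis by (simp add: mult_ac)
    qed
    then have "(\<Sum>i\<in>UNIV. \<bar>(f v - f w) $ i\<bar>) \<le> (\<Sum>i\<in>UNIV. C * (4 * norm (x i)) * norm (v - w))"
      by (intro sum_mono) (simp add: f_def)
    then show ?thesis
      using norm_le_l1_cart[of "f v - f w"] by (simp add: sum_distrib_right)
  qed
  have "negligible (f ` {v. v $ 5 = 0})"
  proof (rule negligible_locally_Lipschitz_image)
    show "negligible {v :: real^5. v $ 5 = 0}"
      using negligible_standard_hyperplane_cart[of "5 :: 5"] by simp
    show "\<exists>T B. open T \<and> v \<in> T \<and> (\<forall>w \<in> {v. v $ 5 = 0} \<inter> T. norm (f w - f v) \<le> B * norm (w - v))" for v
      using lip by (intro exI[of _ UNIV]) auto
  qed simp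
  moreover have "{\<chi> i. N (T (x i)) | T. linear T} \<subseteq> f ` {v. v $ 5 = 0}"
  proof clarify
    fix T :: "real^2 \<Rightarrow> real^2" assume T: "linear T"
    define v :: "real^5" where "v = (\<chi> i. if i = 1 then T (axis 1 1) $ 1 else if i = 2 then T (axis 2 1) $ 1
      else if i = 3 then T (axis 1 1) $ 2 else if i = 4 then T (axis 2 1) $ 2 else 0)"
    have "A v y = T y" for y
    proof -
      have "y = (y $ 1) *\<^sub>R axis 1 1 + (y $ 2) *\<^sub>R axis 2 1"
        by (simp add: vec_eq_iff forall_2 axis_def)
      then have "T y = T ((y $ 1) *\<^sub>R axis 1 1 + (y $ 2) *\<^sub>R axis 2 1)"
        by (rule arg_cong)
      also have "\<dots> = (y $ 1) *\<^sub>R T (axis 1 1) + (y $ 2) *\<^sub>R T (axis 2 1)"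
        by (simp only: linear_add[OF T] linear_scale[OF T])
      finally have "T y = (y $ 1) *\<^sub>R T (axis 1 1) + (y $ 2) *\<^sub>R T (axis 2 1)" .
      then show ?thesis by (simp add: A_def v_def vec_eq_iff forall_2 mult.commute)
    qed
    then have "(\<chi> i. N (T (x i))) = f v" by (simp add: f_def)
    then show "(\<chi> i. N (T (x i))) \<in> f ` {v. v $ 5 = 0}" by (auto simp: v_def)
  qed
  ultimately show ?thesis by (rule negligible_subset)
qed

text \<open>With one representative chosen per class, every \<open>G\<close> is a representative
  composed with a linear map, so countably many null sets cover the value vectors.\<close>

lemma negligible_values_of_countable_classes:
  fixes \<G> :: "(real^2 \<Rightarrow> real) set" and x :: "5 \<Rightarrow> real^2"
  assumes \<G>: "\<And>G. G \<in> \<G> \<Longrightarrow> normed_plane G" and "countable (BM2_of ` \<G>)"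
  shows "negligible ((\<lambda>G. \<chi> i. G (x i)) ` \<G>)"
proof -
  define N where "N = inv_into \<G> (BM2_of :: (real^2 \<Rightarrow> real) \<Rightarrow> BM2)"
  have N: "N X \<in> \<G>" "BM2_of (N X) = X" if "X \<in> BM2_of ` \<G>" for X
    using that by (simp_all add: N_def inv_into_into f_inv_into_f)
  have "negligible (\<Union>X \<in> BM2_of ` \<G>. {\<chi> i. N X (T (x i)) | T. linear T})"
    by (rule negligible_countable_Union)
      (use assms N in \<open>auto intro!: negligible_values_of_isometric_copies\<close>)
  moreover have "(\<lambda>G. \<chi> i. G (x i)) ` \<G> \<subseteq> (\<Union>X \<in> BM2_of ` \<G>. {\<chi> i. N X (T (x i)) | T. linear T})"
  proof clarify
    fix G assume G: "G \<in> \<G>"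
    then have "isometric G (N (BM2_of G))"
      using N[of "BM2_of G"] \<G> BM2_of_eq_iff[of G "N (BM2_of G)"] by simp
    then obtain T where T: "linear T" "\<And>y. N (BM2_of G) (T y) = G y"
      by (auto simp: isometric_def)
    then have "(\<chi> i. G (x i)) = (\<chi> i. N (BM2_of G) (T (x i)))" by simp
    then show "(\<chi> i. G (x i)) \<in> (\<Union>X \<in> BM2_of ` \<G>. {\<chi> i. N X (T (x i)) | T. linear T})"
      using G T(1) by blast
  qed
  ultimately show ?thesis by (rule negligible_subset)
qed

text \<open>Five functionals close to \<open>a\<close>, each dominating at its own point near
  \<open>u\<close>, can be weighted independently. The maximum of \<open>H\<close> and the weighted
  functionals then takes every value vector in a nondegenerate box.\<close>

lemma nonnegligible_values_between:
  fixes H M :: "real^2 \<Rightarrow> real"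
  assumes H: "normed_plane H" and HM: "\<And>x. H x \<le> M x"
    and a: "\<And>x. \<bar>a \<bullet> x\<bar> \<le> M x" and u: "H u < a \<bullet> u"
  shows "\<exists>x :: 5 \<Rightarrow> real^2. \<not> negligible ((\<lambda>G. \<chi> i. G (x i)) `
           {G. normed_plane G \<and> (\<forall>x. H x \<le> G x \<and> G x \<le> M x)})"
proof -
  define \<phi> where "\<phi> = a \<bullet> u"
  \<comment> \<open>Quarter turns of \<open>a\<close> and \<open>u\<close>: \<open>w\<close> spans
    the kernel of \<open>a\<close>, and \<open>b\<close> vanishes at \<open>u\<close>.\<close>
  define w b :: "real^2" where "w = vector [- a $ 2, a $ 1]" and "b = vector [- u $ 2, u $ 1]"
  have inner: "a \<bullet> w = 0" "b \<bullet> u = 0" "b \<bullet> w = \<phi>"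
    by (simp_all add: w_def b_def \<phi>_def inner_vec_def sum_2)
  have Hu: "0 \<le> H u" "0 \<le> H w" by (rule normed_plane_nonneg[OF H])+
  then have \<phi>: "H u < \<phi>" "0 < \<phi>" using u by (auto simp: \<phi>_def)
  have M0: "0 \<le> M x" for x using HM[of x] normed_plane_nonneg[OF H, of x] by linarith
  obtain C where C: "C > 0" "\<And>x. norm x \<le> C * H x" using normed_plane_lower[OF H] by blast
  define K where "K = norm b * C"
  have K: "0 \<le> K" using C by (simp add: K_def)
  have bK: "\<bar>b \<bullet> x\<bar> \<le> K * M x" for x
  proof -
    have "\<bar>b \<bullet> x\<bar> \<le> norm b * norm x" by (rule Cauchy_Schwarz_ineq2)
    also have "\<dots> \<le> norm b * (C * M x)"
      using C order_trans[OF C(2) mult_left_mono[OF HM]] by (intro mult_left_mono) auto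
    finally show ?thesis by (simp add: K_def)
  qed
  \<comment> \<open>Shrinking \<open>a\<close> by the factor \<open>1 - \<eta>\<close> leaves slack
    under \<open>M\<close> for a multiple of \<open>b\<close>, yet stays above \<open>H\<close> at
    \<open>u\<close>.\<close>
  define \<eta> where "\<eta> = min (1/2) ((\<phi> - H u) / (2 * \<phi>))"
  have \<eta>: "0 < \<eta>" "\<eta> \<le> 1/2" "H u < \<phi> * (1 - \<eta>)"
  proof -
    show "0 < \<eta>" "\<eta> \<le> 1/2" using \<phi> by (auto simp: \<eta>_def)
    have "\<eta> * \<phi> \<le> (\<phi> - H u) / (2 * \<phi>) * \<phi>"
      using \<phi> by (intro mult_right_mono) (auto simp: \<eta>_def)
    also have "\<dots> = (\<phi> - H u) / 2" using \<phi> by simp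
    finally show "H u < \<phi> * (1 - \<eta>)" using \<phi> by (simp add: algebra_simps)
  qed
  define g where "g = \<phi> * (1 - \<eta>) - H u"
  \<comment> \<open>The three bounds serve in turn: products of two parameters stay at most 1/9; the
    multiples of \<open>b\<close> fit into the slack \<open>\<eta>\<close>; moving \<open>u\<close>
    along \<open>w\<close> costs less than the gap \<open>g\<close>. The added 1 keeps the
    denominators positive.\<close>
  define \<delta> where "\<delta> = min (1/3) (min (\<eta> / (2 * K + 1)) (g / (H w + 1)))"
  have g: "0 < g" using \<eta> by (simp add: g_def)
  have \<delta>: "0 < \<delta>" using \<eta> g K Hu by (simp add: \<delta>_def)
  have \<delta>_le: "\<delta> \<le> 1/3" "\<delta> \<le> \<eta> / (2 * K + 1)" "\<delta> \<le> g / (H w + 1)" unfolding \<delta>_def by linarith+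
  have \<delta>K: "2 * \<delta> * K \<le> \<eta>"
  proof -
    have "\<delta> * (2 * K + 1) \<le> \<eta>" using K \<delta>_le(2) by (simp add: pos_le_divide_eq)
    then show ?thesis using \<delta> by (simp add: algebra_simps)
  qed
  have \<delta>w: "\<delta> * H w < g"
  proof -
    have "\<delta> * (H w + 1) \<le> g" using Hu \<delta>_le(3) by (simp add: pos_le_divide_eq)
    then show ?thesis using \<delta> by (simp add: algebra_simps)
  qed
  obtain f :: "5 \<Rightarrow> nat" where f: "inj f"
    using finite_imp_inj_to_nat_seg[of "UNIV :: 5 set"] by auto
  \<comment> \<open>Distinct parameters make \<open>A j\<close> strictly the largest of the five
    functionals at \<open>X j\<close>.\<close>
  define \<tau> where "\<tau> i = \<delta> / (1 + real (f i))" for i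
  have \<tau>: "0 < \<tau> i" "\<tau> i \<le> \<delta>" for i
    using \<delta> by (auto simp: \<tau>_def divide_le_eq)
  have \<tau>_inj: "\<tau> i \<noteq> \<tau> j" if "i \<noteq> j" for i j
    using that \<delta> injD[OF f, of i j] by (auto simp: \<tau>_def divide_simps)
  have \<tau>\<tau>: "\<tau> i * \<tau> j \<le> 1/9" for i j
    using mult_mono[of "\<tau> i" "1/3" "\<tau> j" "1/3"] \<tau>[of i] \<tau>[of j] \<delta>_le(1) by auto
  define A where "A i = (1 - \<eta> - (\<tau> i)\<^sup>2) *\<^sub>R a + (2 * \<tau> i) *\<^sub>R b" for i
  define X where "X j = u + \<tau> j *\<^sub>R w" for j
  define R where "R j = \<phi> * (1 - \<eta> + (\<tau> j)\<^sup>2)" for j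
  \<comment> \<open>The \<open>A i\<close> lie on a parabola, so the functional exposed at \<open>X j\<close> is \<open>A j\<close>.\<close>
  have AX: "A i \<bullet> X j = R j - \<phi> * (\<tau> i - \<tau> j)\<^sup>2" for i j
    by (simp add: A_def X_def R_def inner_add_left inner_add_right inner power2_eq_square algebra_simps flip: \<phi>_def)
  have AX0: "0 \<le> A i \<bullet> X j" for i j
  proof -
    have "A i \<bullet> X j = \<phi> * (1 - \<eta> - \<tau> i * \<tau> i + 2 * (\<tau> i * \<tau> j))"
      by (simp add: AX R_def power2_eq_square algebra_simps)
    also have "0 \<le> \<dots>"
      using \<phi> \<eta> \<tau>\<tau>[of i i] mult_pos_pos[OF \<tau>(1)[of i] \<tau>(1)[of j]] by (intro mult_nonneg_nonneg) auto
    finally show ?thesis .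
  qed
  have AM: "\<bar>A i \<bullet> x\<bar> \<le> M x" for i x
  proof -
    have p: "0 \<le> 1 - \<eta> - (\<tau> i)\<^sup>2" using \<eta> \<tau>\<tau>[of i i] by (simp add: power2_eq_square)
    have "\<bar>A i \<bullet> x\<bar> \<le> \<bar>(1 - \<eta> - (\<tau> i)\<^sup>2) * (a \<bullet> x)\<bar> + \<bar>2 * \<tau> i * (b \<bullet> x)\<bar>"
      by (simp add: A_def inner_add_left abs_triangle_ineq)
    also have "\<dots> = (1 - \<eta> - (\<tau> i)\<^sup>2) * \<bar>a \<bullet> x\<bar> + 2 * \<tau> i * \<bar>b \<bullet> x\<bar>"
      using p \<tau>[of i] by (simp add: abs_mult)
    also have "\<dots> \<le> (1 - \<eta> - (\<tau> i)\<^sup>2) * M x + 2 * \<tau> i * (K * M x)"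
      using p a bK \<tau>(1)[of i] by (intro add_mono mult_left_mono) auto
    also have "\<dots> = (1 - \<eta> - (\<tau> i)\<^sup>2 + 2 * \<tau> i * K) * M x" by (simp add: algebra_simps)
    also have "\<dots> \<le> 1 * M x"
    proof (rule mult_right_mono[OF _ M0])
      have "2 * \<tau> i * K \<le> 2 * \<delta> * K" using \<tau>[of i] K by (intro mult_right_mono) auto
      then show "1 - \<eta> - (\<tau> i)\<^sup>2 + 2 * \<tau> i * K \<le> 1" using \<delta>K by (smt (verit) zero_le_power2)
    qed
    finally show ?thesis by simp
  qed
  have HX: "H (X j) < R j" for j
  proof -
    have "H (X j) \<le> H u + \<tau> j * H w"
      using normed_plane_add[OF H, of u "\<tau> j *\<^sub>R w"] \<tau>(1)[of j] by (simp add: X_def normed_plane_scale[OF H])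
    also have "\<dots> \<le> H u + \<delta> * H w" using \<tau>[of j] Hu by (intro add_left_mono mult_right_mono) auto
    also have "\<dots> < \<phi> * (1 - \<eta>)" using \<delta>w by (simp add: g_def)
    also have "\<dots> \<le> R j" using \<phi> by (simp add: R_def)
    finally show ?thesis .
  qed
  have R: "0 < R j" for j using HX[of j] normed_plane_nonneg[OF H, of "X j"] by linarith
  \<comment> \<open>The largest value at \<open>X j\<close> forced by \<open>H\<close> and by the
    other functionals at full weight; the slot \<open>i = j\<close> carries \<open>H\<close>. Above
    \<open>L j\<close> the value depends on the weight of \<open>A j\<close> alone.\<close>
  define L where "L j = Max (range (\<lambda>i. if i = j then H (X j) else \<bar>A i \<bullet> X j\<bar>))" for j
  have L: "(if i = j then H (X j) else \<bar>A i \<bullet> X j\<bar>) \<le> L j" for i j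
    unfolding L_def by (rule Max_ge) auto
  have "L j < R j" for j
    unfolding L_def using HX[of j] AX0[of _ j] \<phi> \<tau>_inj[of _ j] by (auto simp: AX)
  then have "\<not> negligible (cbox (\<chi> j. L j) (\<chi> j. R j))"
    by (simp add: negligible_interval interval_eq_empty_cart not_le)
  moreover have "cbox (\<chi> j. L j) (\<chi> j. R j) \<subseteq>
      (\<lambda>G. \<chi> i. G (X i)) ` {G. normed_plane G \<and> (\<forall>x. H x \<le> G x \<and> G x \<le> M x)}"
  proof
    fix v assume "v \<in> cbox (\<chi> j. L j) (\<chi> j. R j)"
    then have v: "L j \<le> v $ j" "v $ j \<le> R j" for j by (auto simp: mem_box_cart)
    \<comment> \<open>With this weight the functional \<open>A i\<close> contributes exactly
      \<open>v $ i\<close> at \<open>X i\<close>; weights of at most 1 keep the maximum below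
      \<open>M\<close>.\<close>
    define c where "c i = v $ i / R i" for i
    have v0: "H (X i) \<le> v $ i" "0 \<le> v $ i" for i
      using L[of i i] v(1)[of i] normed_plane_nonneg[OF H, of "X i"] by auto
    then have c: "0 \<le> c i" "c i \<le> 1" for i
      using v(2)[of i] R[of i] by (auto simp: c_def)
    define G where "G x = Max (range (\<lambda>i. max (H x) (c i * \<bar>A i \<bullet> x\<bar>)))" for x
    have ge: "max (H x) (c i * \<bar>A i \<bullet> x\<bar>) \<le> G x" for i x
      unfolding G_def by (rule Max_ge) auto
    have cle: "c i * \<bar>A i \<bullet> x\<bar> \<le> \<bar>A i \<bullet> x\<bar>" for i x
      using c[of i] by (simp add: mult_left_le_one_le)
    have "normed_plane G"
      unfolding G_def by (intro normed_plane_Max normed_plane_max_functional H c)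
    moreover have "H x \<le> G x \<and> G x \<le> M x" for x
      using ge[of x 0] order_trans[OF cle AM] HM by (auto simp: G_def)
    moreover have "G (X j) = v $ j" for j
    proof (rule antisym)
      have "c i * \<bar>A i \<bullet> X j\<bar> \<le> v $ j" for i
      proof (cases "i = j")
        case True
        then show ?thesis using R[of j] by (simp add: c_def AX)
      next
        case False
        then show ?thesis using cle[of i "X j"] L[of i j] v(1)[of j] by simp
      qed
      then show "G (X j) \<le> v $ j" using v0[of j] by (auto simp: G_def)
      show "v $ j \<le> G (X j)" using ge[of "X j" j] R[of j] by (simp add: c_def AX)
    qed
    then have "v = (\<chi> i. G (X i))" by (simp add: vec_eq_iff)
    ultimately show "v \<in> (\<lambda>G. \<chi> i. G (X i)) ` {G. normed_plane G \<and> (\<forall>x. H x \<le> G x \<and> G x \<le> M x)}"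
      by blast
  qed
  ultimately show ?thesis using negligible_subset by blast
qed

section \<open>Room between the bounds on intermediate norms\<close>

text \<open>For a splitting \<open>u = p + q\<close>, the cost \<open>F p + s * E q\<close> exceeds
  \<open>E u\<close> by at least \<open>\<kappa> * E q\<close>, from \<open>E \<le> F\<close>, and
  by at least \<open>\<kappa> * F p\<close>, from \<open>F \<le> s\<^sup>2 * E\<close> after
  division by \<open>s\<close>. As \<open>E q + F p\<close> is at least \<open>E u\<close>,
  averaging gives a gain proportional to \<open>E u\<close>.\<close>

lemma ex_functional_above_lower_norm:
  fixes E F :: "real^2 \<Rightarrow> real"
  assumes E: "normed_plane E" and F: "normed_plane F" and s: "1 < s"
    and EF: "\<And>x. E x \<le> F x" "\<And>x. F x \<le> s\<^sup>2 * E x"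
    and u: "u \<noteq> 0" "F u = s * E u"
  shows "\<exists>a. (\<forall>x. \<bar>a \<bullet> x\<bar> \<le> min (F x) (s * E x)) \<and> E u < a \<bullet> u"
proof -
  define \<kappa> where "\<kappa> = 1 - 1 / s"
  have \<kappa>: "0 < \<kappa>" "\<kappa> \<le> s - 1"
  proof -
    show "0 < \<kappa>" using s by (simp add: \<kappa>_def)
    have "0 \<le> (s - 1) * (s - 1) / s" using s by simp
    also have "\<dots> = s - 1 - \<kappa>" using s by (simp add: \<kappa>_def field_simps)
    finally show "\<kappa> \<le> s - 1" by simp
  qed
  have Eu: "0 < E u" by (rule normed_plane_pos[OF E u(1)])
  have sE: "normed_plane (\<lambda>x. s * E x)" using s by (intro normed_plane_cmult E) auto
  \<comment> \<open>Averaging yields the factor \<open>1 + \<kappa> / 2\<close>;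
    \<open>\<kappa> / 4\<close> provides the strict inequality required for separation.\<close>
  have "(1 + \<kappa> / 4) * E u < F p + s * E (u - p)" for p
  proof -
    let ?q = "u - p"
    have Epq: "E u \<le> E p + E ?q" and Fpq: "F u \<le> F p + F ?q"
      using normed_plane_add[OF E, of p ?q] normed_plane_add[OF F, of p ?q] by simp_all
    have "\<kappa> * E ?q \<le> (s - 1) * E ?q" using \<kappa> normed_plane_nonneg[OF E] by (intro mult_right_mono) auto
    then have 1: "E u + \<kappa> * E ?q \<le> F p + s * E ?q"
      using EF(1)[of p] Epq by (simp add: algebra_simps)
    have "s * (E u + \<kappa> * F p) \<le> s * (F p + s * E ?q)"
      using EF(2)[of ?q] Fpq s u(2) by (simp add: \<kappa>_def power2_eq_square algebra_simps)
    then have 2: "E u + \<kappa> * F p \<le> F p + s * E ?q" using s by simp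
    have "E u \<le> E ?q + F p" using EF(1)[of p] Epq by simp
    then have "\<kappa> * E u \<le> \<kappa> * E ?q + \<kappa> * F p"
      using mult_left_mono[of "E u" "E ?q + F p" \<kappa>] \<kappa> by (simp add: distrib_left)
    then have "E u + \<kappa> * E u / 2 \<le> F p + s * E ?q" using 1 2 by linarith
    moreover have "0 < \<kappa> * E u" using \<kappa> Eu by simp
    ultimately show ?thesis by (simp add: algebra_simps)
  qed
  then obtain a where a: "\<And>x. a \<bullet> x \<le> F x" "\<And>x. a \<bullet> x \<le> s * E x" "(1 + \<kappa> / 4) * E u \<le> a \<bullet> u"
    using ex_functional_below_two_norms[OF F sE, of "(1 + \<kappa> / 4) * E u" u] \<kappa> Eu by auto
  have "\<bar>a \<bullet> x\<bar> \<le> min (F x) (s * E x)" for x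
    using a(1,2)[of x] a(1,2)[of "- x"] by (auto simp: normed_plane_minus[OF E] normed_plane_minus[OF F])
  moreover have "E u < (1 + \<kappa> / 4) * E u" using \<kappa> Eu by simp
  ultimately show ?thesis using a(3) by (meson less_le_trans)
qed

text \<open>If \<open>F / E\<close> stayed on one side of \<open>s\<close>, the identity would have
  distortion at most \<open>s\<close>, below the distance \<open>s\<^sup>2\<close>. So
  \<open>F - s * E\<close> takes both signs on the punctured plane, which is connected.\<close>

lemma ex_intermediate_ratio:
  fixes E F :: "real^2 \<Rightarrow> real"
  assumes E: "normed_plane E" and F: "normed_plane F" and s: "1 < s"
    and bm: "banach_mazur E F = s\<^sup>2"
    and EF: "\<And>x. E x \<le> F x" "\<And>x. F x \<le> s\<^sup>2 * E x"
  shows "\<exists>u. u \<noteq> 0 \<and> F u = s * E u"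
proof -
  define h where "h x = F x - s * E x" for x
  have s2: "s < s\<^sup>2" using s by (simp add: power2_eq_square)
  have "\<exists>x. h x < 0"
  proof (rule ccontr)
    assume "\<not> ?thesis"
    then have "banach_mazur E F \<le> s\<^sup>2 / s"
      using s EF by (intro banach_mazur_le[OF E F]) (auto simp: h_def not_less)
    then show False using bm s s2 by (simp add: power2_eq_square)
  qed
  moreover have "\<exists>x. 0 < h x"
  proof (rule ccontr)
    assume "\<not> ?thesis"
    then have "banach_mazur E F \<le> s / 1"
      using s EF by (intro banach_mazur_le[OF E F]) (auto simp: h_def not_less)
    then show False using bm s2 by simp
  qed
  ultimately obtain x y where xy: "h x < 0" "0 < h y" by blast
  have "h 0 = 0" by (simp add: h_def normed_plane_zero E F)
  then have mem: "h x \<in> h ` (- {0})" "h y \<in> h ` (- {0})" using xy by auto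
  have "connected (h ` (- {0}))"
    unfolding h_def
    by (intro connected_continuous_image continuous_intros normed_plane_continuous E F
        connected_punctured_universe) simp
  then have "0 \<in> h ` (- {0})"
    using connectedD_interval[OF _ mem, of 0] xy by simp
  then show ?thesis by (auto simp: h_def)
qed

lemma uncountable_classes_between:
  fixes E F :: "real^2 \<Rightarrow> real"
  assumes E: "normed_plane E" and F: "normed_plane F" and s: "1 < s"
    and bm: "banach_mazur E F = s\<^sup>2"
    and EF: "\<And>x. E x \<le> F x" "\<And>x. F x \<le> s\<^sup>2 * E x"
  shows "uncountable (BM2_of ` {G. normed_plane G \<and>
           (\<forall>x. E x \<le> G x \<and> G x \<le> s * E x \<and> G x \<le> F x \<and> F x \<le> s * G x)})"
proof -
  obtain u where u: "u \<noteq> 0" "F u = s * E u"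
    using ex_intermediate_ratio[OF E F s bm EF] by blast
  obtain a where a: "\<And>x. \<bar>a \<bullet> x\<bar> \<le> min (F x) (s * E x)" "E u < a \<bullet> u"
    using ex_functional_above_lower_norm[OF E F s EF u] by blast
  define H where "H x = max (E x) ((1 / s) * F x)" for x
  have H: "normed_plane H"
    unfolding H_def using s by (intro normed_plane_max normed_plane_cmult E F) auto
  have "H x \<le> min (F x) (s * E x)" for x
  proof -
    have "E x \<le> s * E x" "F x \<le> s * F x"
      using s normed_plane_nonneg[OF E, of x] normed_plane_nonneg[OF F, of x] by (simp_all add: mult_le_cancel_right1)
    then show ?thesis using s EF[of x] by (simp add: H_def field_simps power2_eq_square)
  qed
  \<comment> \<open>At \<open>u\<close> both terms of \<open>H\<close> equal \<open>E u\<close>,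
    because \<open>F u = s * E u\<close>.\<close>
  moreover have "H u < a \<bullet> u" using a(2) s u(2) by (simp add: H_def)
  ultimately obtain x :: "5 \<Rightarrow> real^2" where x: "\<not> negligible ((\<lambda>G. \<chi> i. G (x i)) `
      {G. normed_plane G \<and> (\<forall>x. H x \<le> G x \<and> G x \<le> min (F x) (s * E x))})"
    using nonnegligible_values_between[OF H _ a(1)] by blast
  have "{G. normed_plane G \<and> (\<forall>x. H x \<le> G x \<and> G x \<le> min (F x) (s * E x))} =
      {G. normed_plane G \<and> (\<forall>x. E x \<le> G x \<and> G x \<le> s * E x \<and> G x \<le> F x \<and> F x \<le> s * G x)}"
    using s by (auto simp: H_def field_simps)
  then show ?thesis
    using x negligible_values_of_countable_classes[of _ x] by (metis (no_types, lifting) mem_Collect_eq)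
qed

section \<open>From intermediate norms to geodesics\<close>

theorem mainTheorem6:
  fixes E :: "'a::real_vector \<Rightarrow> real" and F :: "'b::real_vector \<Rightarrow> real"
  assumes "normed_plane E" and "normed_plane F" and "\<not> isometric E F"
  shows "uncountable {\<gamma> ` {a..b} | (\<gamma> :: real \<Rightarrow> BM2) a b. geodesic \<gamma> a b (BM2_of E) (BM2_of F)}"
proof
  let ?I = "{\<gamma> ` {a..b} | (\<gamma> :: real \<Rightarrow> BM2) a b. geodesic \<gamma> a b (BM2_of E) (BM2_of F)}"
  assume "countable ?I"
  obtain E' :: "real^2 \<Rightarrow> real" where E': "normed_plane E'" "isometric E' E"
    using normed_plane_coordinates[OF assms(1)] by blast
  obtain F0 :: "real^2 \<Rightarrow> real" where F0: "normed_plane F0" "isometric F0 F"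
    using normed_plane_coordinates[OF assms(2)] by blast
  define d where "d = banach_mazur E' F0"
  obtain T where T: "linear T" "bij T" "\<And>x. E' x \<le> F0 (T x)" "\<And>x. F0 (T x) \<le> d * E' x"
    using banach_mazur_attained[OF E'(1) F0(1)] unfolding d_def by blast
  \<comment> \<open>Pulling \<open>F0\<close> back along an optimal isomorphism makes the identity
    optimal between \<open>E'\<close> and \<open>F'\<close>.\<close>
  define F' where "F' x = F0 (T x)" for x
  have F': "normed_plane F'" "isometric F' F0"
    unfolding F'_def using T normed_plane_compose[OF F0(1)] by (auto simp: isometric_def)
  have d: "banach_mazur E' F' = d"
    unfolding d_def using E'(1) F'(1) F0(1) isometric_refl F'(2) by (rule banach_mazur_cong[OF E'(1)])
  have eq: "BM2_of E = BM2_of E'" "BM2_of F = BM2_of F'"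
    using assms(1,2) E' F' F0 isometric_sym isometric_trans by (metis BM2_of_eq_iff)+
  have "1 \<le> d" unfolding d_def by (rule banach_mazur_ge_1[OF E'(1) F0(1)])
  moreover have "d \<noteq> 1"
    using assms E' F' eq d by (metis BM2_of_eq_iff banach_mazur_eq_1_iff)
  ultimately have "1 < sqrt d" "(sqrt d)\<^sup>2 = d" by auto
  then obtain s where s: "1 < s" "d = s\<^sup>2" by metis
  have bm: "banach_mazur E' F' = s\<^sup>2" using d s(2) by simp
  let ?\<G> = "{G. normed_plane G \<and>
    (\<forall>x. E' x \<le> G x \<and> G x \<le> s * E' x \<and> G x \<le> F' x \<and> F' x \<le> s * G x)}"
  \<comment> \<open>Each class is recovered as the only point of some geodesic image at distance
    \<open>ln s\<close> from \<open>E\<close>. On images without a unique such point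
    \<open>the_elem\<close> is unspecified, which is harmless for an inclusion.\<close>
  have "BM2_of ` ?\<G> \<subseteq> (\<lambda>I. the_elem (I \<inter> {X. dist (BM2_of E) X = ln s})) ` ?I"
  proof (rule image_subsetI)
    fix G assume "G \<in> ?\<G>"
    then have G: "normed_plane G" "\<And>x. E' x \<le> G x" "\<And>x. G x \<le> s * E' x" "\<And>x. G x \<le> F' x"
      "\<And>x. F' x \<le> s * G x" by simp_all
    obtain \<gamma> a b where "geodesic \<gamma> a b (BM2_of E) (BM2_of F)"
      and "\<gamma> ` {a..b} \<inter> {X. dist (BM2_of E) X = ln s} = {BM2_of G}"
      using geodesic_through_intermediate_norm[OF E'(1) F'(1) G(1) s(1) bm G(2-5)] unfolding eq by blast
    then show "BM2_of G \<in> (\<lambda>I. the_elem (I \<inter> {X. dist (BM2_of E) X = ln s})) ` ?I"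
      by (intro image_eqI[of _ _ "\<gamma> ` {a..b}"]) auto
  qed
  then have "countable (BM2_of ` ?\<G>)"
    by (rule countable_subset) (rule countable_image[OF \<open>countable ?I\<close>])
  moreover have "uncountable (BM2_of ` ?\<G>)"
    using uncountable_classes_between[OF E'(1) F'(1) s(1) bm] s(2) T(3,4) by (simp add: F'_def)
  ultimately show False by blast
qed

end
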